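(* Let $\phi$ be an analytic map with $\phi(\mathbb{D})\subset\mathbb{D}$, which is not an elliptic automorphism, and let $\tau_\phi\in\overline{\mathbb{D}}$ be its Denjoy-Wolff point. Let $\{w_n\}_{n=0}^{\infty}\subset\mathbb{D}$ be a backward-iteration sequence for $\phi$, i.e. $\phi(w_{n+1})=w_n$ for $n=0,1,2,\dots$, which is not the constant sequence $w_n\equiv\tau_\phi$, and which has bounded pseudo-hyperbolic steps $d_n=d(w_n,w_{n+1})\uparrow a<1$. Then the following hold: (1) There is a point $\zeta\in\partial\mathbb{D}$ such that $w_n\to\zeta$ as $n\to\infty$, and $\zeta$ is a fixed point for $\phi$ with a well-defined multiplier $\phi'(\zeta)<\infty$. (2) When $\zeta\neq\tau_\phi$, then $\zeta$ is a boundary repelling fixed point (BRFP) of $\phi$. If $\zeta=\tau_\phi$, then $\phi$ is necessarily of parabolic type. (3) When $\zeta$ is a BRFP, the sequence $w_n$ tends to $\zeta$ along a non-tangential direction. More precisely, there exists an angle $\theta_0\in(-\pi/2,\pi/2)$ such that $$\arg(\zeta-w_n)-\arg\zeta\longrightarrow\theta_0\qquad\text{as } n\to\infty .$$ (4) When, in the parabolic case, $\zeta=\tau_\phi$, then $w_n$ tends to $\zeta$ tangentially.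
   Context: $\mathbb{D}$ is the open unit disk and $d(z,w)=|z-w|/|1-\overline{z}w|$ is the pseudo-hyperbolic distance on $\mathbb{D}$. The notation $d_n\uparrow a$ means that $d_n$ is non-decreasing with limit $a$. Denjoy-Wolff point: if $\phi$ is an analytic self-map of $\mathbb{D}$ that is not an elliptic automorphism (the identity being excluded as well), the iterates $\phi_n$ of $\phi$ converge uniformly on compact subsets of $\mathbb{D}$ to a point $\tau_\phi\in\overline{\mathbb{D}}$, called the Denjoy-Wolff point. Boundary fixed points: $\zeta\in\partial\mathbb{D}$ is a (boundary) fixed point of $\phi$ if $\phi(z)\to\zeta$ as $z\to\zeta$ non-tangentially; its multiplier $\phi'(\zeta)$ is the angular derivative, i.e. the non-tangential limit of $\phi'(z)$ at $\zeta$ (possibly infinite). When $\tau_\phi\in\partial\mathbb{D}$, it is a fixed point with multiplier $0<\phi'(\tau_\phi)\le 1$. Any boundary fixed point other than $\tau_\phi$ has multiplier in $(1,\infty]$. A boundary repelling fixed point (BRFP) is a boundary fixed point $\zeta\ne\tau_\phi$ whose multiplier is finite, $1<\phi'(\zeta)<\infty$. Types: $\phi$ is elliptic if $\tau_\phi\in\mathbb{D}$, hyperbolic if $\tau_\phi\in\partial\mathbb{D}$ and $\phi'(\tau_\phi)<1$, and parabolic if $\tau_\phi\in\partial\mathbb{D}$ and $\phi'(\tau_\phi)=1$. In (3) the difference of arguments is understood modulo $2\pi$, i.e. it is the principal argument of $1-\overline{\zeta}w_n$. In (4), $w_n\to\zeta$ tangentially means $(1-|w_n|)/|\zeta-w_n|\to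 0$. *)

theory Defs
  imports "HOL-Complex_Analysis.Complex_Analysis"
begin

abbreviation unit_disk :: "complex set" where
  "unit_disk \<equiv> ball 0 1"

definition pseudo_hyp_dist :: "complex \<Rightarrow> complex \<Rightarrow> real" where
  "pseudo_hyp_dist z w = norm (z - w) / norm (1 - cnj z * w)"

definition analytic_self_map :: "(complex \<Rightarrow> complex) \<Rightarrow> bool" where
  "analytic_self_map \<phi> \<longleftrightarrow> \<phi> holomorphic_on unit_disk \<and> \<phi> ` unit_disk \<subseteq> unit_disk"

text \<open>The identity counts as an elliptic automorphism. Holomorphy of the inverse map is automatic.\<close>
definition elliptic_automorphism :: "(complex \<Rightarrow> complex) \<Rightarrow> bool" where
  "elliptic_automorphism \<phi> \<longleftrightarrow>
     \<phi> holomorphic_on unit_disk \<and> bij_betw \<phi> unit_disk unit_disk \<and> (\<exists>z\<in>unit_disk. \<phi> z = z)"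

definition denjoy_wolff_point :: "(complex \<Rightarrow> complex) \<Rightarrow> complex \<Rightarrow> bool" where
  "denjoy_wolff_point \<phi> \<tau> \<longleftrightarrow> \<tau> \<in> cball 0 1 \<and>
     (\<forall>K. compact K \<and> K \<subseteq> unit_disk \<longrightarrow> uniform_limit K (\<lambda>n. \<phi> ^^ n) (\<lambda>_. \<tau>) sequentially)"

text \<open>For \<open>M \<le> 1\<close> the region is empty, so such \<open>M\<close> impose no condition on non-tangential limits.\<close>
definition stolz_region :: "complex \<Rightarrow> real \<Rightarrow> complex set" where
  "stolz_region \<zeta> M = {z \<in> unit_disk. norm (\<zeta> - z) < M * (1 - norm z)}"

definition nontangential_limit :: "(complex \<Rightarrow> complex) \<Rightarrow> complex \<Rightarrow> complex \<Rightarrow> bool" where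
  "nontangential_limit f \<zeta> l \<longleftrightarrow> (\<forall>M. (f \<longlongrightarrow> l) (at \<zeta> within stolz_region \<zeta> M))"

definition boundary_fixed_point :: "(complex \<Rightarrow> complex) \<Rightarrow> complex \<Rightarrow> bool" where
  "boundary_fixed_point \<phi> \<zeta> \<longleftrightarrow> \<zeta> \<in> sphere 0 1 \<and> nontangential_limit \<phi> \<zeta> \<zeta>"

text \<open>\<open>has_multiplier \<phi> \<zeta> m\<close>: the angular derivative of \<open>\<phi>\<close> at \<open>\<zeta>\<close> exists and is the (finite) real
  number \<open>m\<close>. An infinite multiplier satisfies this for no \<open>m\<close>.\<close>
definition has_multiplier :: "(complex \<Rightarrow> complex) \<Rightarrow> complex \<Rightarrow> real \<Rightarrow> bool" where
  "has_multiplier \<phi> \<zeta> m \<longleftrightarrow> nontangential_limit (deriv \<phi>) \<zeta> (of_real m)"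

text \<open>The second argument is the Denjoy-Wolff point of \<open>\<phi>\<close>.\<close>
definition BRFP :: "(complex \<Rightarrow> complex) \<Rightarrow> complex \<Rightarrow> complex \<Rightarrow> bool" where
  "BRFP \<phi> \<tau> \<zeta> \<longleftrightarrow>
     boundary_fixed_point \<phi> \<zeta> \<and> \<zeta> \<noteq> \<tau> \<and> (\<exists>m. has_multiplier \<phi> \<zeta> m \<and> 1 < m)"

definition parabolic_type :: "(complex \<Rightarrow> complex) \<Rightarrow> complex \<Rightarrow> bool" where
  "parabolic_type \<phi> \<tau> \<longleftrightarrow> denjoy_wolff_point \<phi> \<tau> \<and> \<tau> \<in> sphere 0 1 \<and> has_multiplier \<phi> \<tau> 1"

definition backward_iteration :: "(complex \<Rightarrow> complex) \<Rightarrow> (nat \<Rightarrow> complex) \<Rightarrow> bool" where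
  "backward_iteration \<phi> w \<longleftrightarrow> (\<forall>n. w n \<in> unit_disk \<and> \<phi> (w (Suc n)) = w n)"

definition tends_tangentially :: "(nat \<Rightarrow> complex) \<Rightarrow> complex \<Rightarrow> bool" where
  "tends_tangentially w \<zeta> \<longleftrightarrow>
     w \<longlonglongrightarrow> \<zeta> \<and> (\<lambda>n. (1 - norm (w n)) / norm (\<zeta> - w n)) \<longlonglongrightarrow> 0"

end

theory Submission
  imports Defs
begin

text \<open>
  Along the orbit the ratios \<open>(1 - |w\<^sub>n|) / (1 - |w\<^sub>n\<^sub>+\<^sub>1|)\<close> are bounded, so Julia's lemma holds with one
  constant at every cluster point. If there were two cluster points, there would be an arc of them,
  \<open>\<phi> z - z\<close> would vanish on this arc, and \<open>\<phi>\<close> would be the identity. At the limit \<open>\<zeta>\<close> pass to the right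
  half-plane with \<open>\<zeta>\<close> at infinity: \<open>\<phi>\<close> becomes \<open>F\<close>, the orbit becomes \<open>F U\<^sub>n\<^sub>+\<^sub>1 = U\<^sub>n\<close>, and the multiplier is
  \<open>1 / c\<close> for the largest \<open>c\<close> with \<open>Re F \<ge> c Re\<close>. The steps \<open>|U\<^sub>n - U\<^sub>n\<^sub>+\<^sub>1|\<close> are of the order of \<open>Re U\<^sub>n\<close>, so
  \<open>Re U\<^sub>n\<close> cannot decay geometrically, as \<open>U\<^sub>n\<close> would converge; this gives \<open>c \<le> 1\<close>. If \<open>c < 1\<close>, then
  \<open>F u \<sim> c u\<close> in sectors and boundedness of the steps keep an orbit that is far out in a sector
  inside one; the alternative, a purely tangential orbit, is compared by the Schwarz--Pick lemma with
  the real points \<open>|U\<^sub>n|\<close>, and \<open>Re U\<^sub>n\<close> would again decay geometrically. In a sector,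
  \<open>U\<^sub>n / U\<^sub>n\<^sub>+\<^sub>1 \<rightarrow> c\<close>, and the limit of the hyperbolic steps determines the limit of \<open>|Arg U\<^sub>n|\<close>.
\<close>

subsection \<open>The Cayley transform\<close>

abbreviation right_half_plane :: "complex set" where
  "right_half_plane \<equiv> {u. Re u > 0}"

text \<open>For \<open>norm \<zeta> = 1\<close> this maps the disk onto the right half-plane and
  sends \<open>\<zeta>\<close> to infinity; non-tangential approach to \<open>\<zeta>\<close>
  becomes escape to infinity inside a sector.\<close>

definition cayley :: "complex \<Rightarrow> complex \<Rightarrow> complex" where
  "cayley \<zeta> z = (\<zeta> + z) / (\<zeta> - z)"

definition cayley_inv :: "complex \<Rightarrow> complex \<Rightarrow> complex" where
  "cayley_inv \<zeta> u = \<zeta> * (u - 1) / (u + 1)"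

text \<open>Its use is to trade the pseudo-hyperbolic distance for the ratio |z - w|^2 / ((1 -
  |z|^2) (1 - |w|^2)), the form in which the estimates below are made.\<close>

lemma norm_one_minus_cnj_mult_sq:
  "(norm (1 - cnj z * w))\<^sup>2 = (norm (z - w))\<^sup>2 + (1 - (norm z)\<^sup>2) * (1 - (norm w)\<^sup>2)"
  unfolding cmod_power2 by (simp add: algebra_simps power2_eq_square)

lemma norm_less_1_iff_sq: "norm (z::complex) < 1 \<longleftrightarrow> 0 < 1 - (norm z)\<^sup>2"
  by (simp add: abs_square_less_1)

lemma norm_add_cnj_sq: "(norm (u + cnj v))\<^sup>2 = (norm (u - v))\<^sup>2 + 4 * Re u * Re v"
  unfolding cmod_power2 by (simp add: algebra_simps power2_eq_square)

lemma cayley_diff: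
  assumes "\<zeta> \<noteq> z" "\<zeta> \<noteq> w"
  shows "cayley \<zeta> z - cayley \<zeta> w = 2 * \<zeta> * (z - w) / ((\<zeta> - z) * (\<zeta> - w))"
  using assms by (simp add: cayley_def divide_simps) (simp add: algebra_simps)

lemma cayley_plus_1: "\<zeta> \<noteq> z \<Longrightarrow> cayley \<zeta> z + 1 = 2 * \<zeta> / (\<zeta> - z)"
  by (simp add: cayley_def divide_simps)

text \<open>The right-hand side is the Poisson kernel, so the sets where it exceeds a constant are
  the horodisks at \<open>\<zeta>\<close>.\<close>

lemma Re_cayley:
  assumes "norm \<zeta> = 1"
  shows "Re (cayley \<zeta> z) = (1 - (norm z)\<^sup>2) / (norm (\<zeta> - z))\<^sup>2"
proof -
  have "Re (cayley \<zeta> z) = Re ((\<zeta> + z) * cnj (\<zeta> - z)) / (norm (\<zeta> - z))\<^sup>2"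
    unfolding cayley_def by (subst complex_div_cnj) (simp flip: of_real_power)
  moreover have "Re ((\<zeta> + z) * cnj (\<zeta> - z)) = (norm \<zeta>)\<^sup>2 - (norm z)\<^sup>2"
    unfolding cmod_power2 by (simp add: algebra_simps power2_eq_square)
  ultimately show ?thesis using assms by simp
qed

lemma Re_cayley_pos:
  assumes "norm \<zeta> = 1" "norm z < 1"
  shows "Re (cayley \<zeta> z) > 0"
proof -
  have "\<zeta> \<noteq> z" using assms by auto
  thus ?thesis
    unfolding Re_cayley[OF assms(1)] using assms(2) norm_less_1_iff_sq[of z]
    by (intro divide_pos_pos) auto
qed

lemma cayley_inv_cayley: "\<zeta> \<noteq> z \<Longrightarrow> \<zeta> \<noteq> 0 \<Longrightarrow> cayley_inv \<zeta> (cayley \<zeta> z) = z"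
  unfolding cayley_inv_def cayley_plus_1
  by (simp add: cayley_def divide_simps)

lemma cayley_cayley_inv: "u \<noteq> -1 \<Longrightarrow> \<zeta> \<noteq> 0 \<Longrightarrow> cayley \<zeta> (cayley_inv \<zeta> u) = u"
proof -
  assume u: "u \<noteq> -1" and z: "\<zeta> \<noteq> 0"
  hence u': "u + 1 \<noteq> 0" by (simp add: add_eq_0_iff2)
  have "\<zeta> + cayley_inv \<zeta> u = 2 * \<zeta> * u / (u + 1)" "\<zeta> - cayley_inv \<zeta> u = 2 * \<zeta> / (u + 1)"
    using u' by (simp_all add: cayley_inv_def divide_simps) (simp_all add: algebra_simps)
  thus ?thesis using u' z by (simp add: cayley_def)
qed

lemma norm_cayley_inv_less_1:
  assumes "norm \<zeta> = 1" "Re u > 0"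
  shows "norm (cayley_inv \<zeta> u) < 1"
proof -
  have "(norm (u - 1))\<^sup>2 < (norm (u + 1))\<^sup>2"
    using assms norm_add_cnj_sq[of u 1] by simp
  hence "norm (u - 1) < norm (u + 1)" by (rule power_less_imp_less_base) simp
  moreover from this have "0 < norm (u + 1)" using norm_ge_zero order_le_less_trans by blast
  ultimately show ?thesis using assms
    by (simp add: cayley_inv_def norm_mult norm_divide)
qed

lemma cayley_holomorphic: "norm \<zeta> = 1 \<Longrightarrow> cayley \<zeta> holomorphic_on ball 0 1"
  unfolding cayley_def by (intro holomorphic_intros) auto

lemma cayley_inv_holomorphic: "cayley_inv \<zeta> holomorphic_on right_half_plane"
  unfolding cayley_inv_def by (intro holomorphic_intros) (auto simp: add_eq_0_iff2)

text \<open>The distances to \<open>\<zeta>\<close> in \<open>cayley_diff\<close> and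
  \<open>Re_cayley\<close> cancel. Up to the factor 4, the invariant ratio of the disk thus becomes
  |u - v|^2 / (Re u Re v) in the half-plane.\<close>

lemma cayley_half_plane_invariant:
  assumes "norm \<zeta> = 1" "norm z < 1" "norm w < 1"
  shows "(norm (cayley \<zeta> z - cayley \<zeta> w))\<^sup>2 * ((1 - (norm z)\<^sup>2) * (1 - (norm w)\<^sup>2))
       = 4 * (norm (z - w))\<^sup>2 * (Re (cayley \<zeta> z) * Re (cayley \<zeta> w))"
proof -
  have ne: "\<zeta> \<noteq> z" "\<zeta> \<noteq> w" using assms by auto
  show ?thesis
    unfolding cayley_diff[OF ne] Re_cayley[OF assms(1)]
    using assms(1) ne by (simp add: norm_mult norm_divide power_mult_distrib power_divide)
qed

subsection \<open>The Schwarz--Pick lemma\<close>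

text \<open>Moebius maps moving \<open>w\<close> and \<open>f w\<close> to 0 reduce this to the
  Schwarz lemma. The cross-multiplied form avoids divisions and carries over to the
  half-plane.\<close>

lemma Schwarz_Pick_disk:
  assumes hol: "f holomorphic_on ball 0 1" and f: "\<And>z. norm z < 1 \<Longrightarrow> norm (f z) < 1"
    and z: "norm z < 1" and w: "norm w < 1"
  shows "(norm (f z - f w))\<^sup>2 * ((1 - (norm z)\<^sup>2) * (1 - (norm w)\<^sup>2))
       \<le> (norm (z - w))\<^sup>2 * ((1 - (norm (f z))\<^sup>2) * (1 - (norm (f w))\<^sup>2))"
proof -
  define g where "g = Moebius_function 0 (f w) \<circ> f \<circ> Moebius_function 0 (-w)"
  have w': "norm (-w) < 1" using w by simp
  have im: "Moebius_function 0 (-w) ` ball 0 1 \<subseteq> ball 0 1" "f ` ball 0 1 \<subseteq> ball 0 1"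
    using Moebius_function_norm_lt_1[OF w'] f by (auto simp: image_subset_iff)
  have "g holomorphic_on ball 0 1"
    unfolding g_def
    by (rule holomorphic_on_compose_gen[OF Moebius_function_holomorphic[OF w']
          holomorphic_on_compose_gen[OF hol Moebius_function_holomorphic[OF f[OF w]] im(2)] im(1)])
  moreover have "g 0 = 0"
    by (simp add: g_def Moebius_function_def)
  moreover have "norm (g x) < 1" if "norm x < 1" for x
  proof -
    have "norm (Moebius_function 0 (-w) x) < 1" by (rule Moebius_function_norm_lt_1[OF w' that])
    thus ?thesis unfolding g_def comp_def by (rule Moebius_function_norm_lt_1[OF f[OF w] f])
  qed
  ultimately have "norm (g (Moebius_function 0 w z)) \<le> norm (Moebius_function 0 w z)"
    by (rule Schwarz_Lemma(1)[OF _ _ _ Moebius_function_norm_lt_1[OF w z]])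
  moreover have "Moebius_function 0 (-w) (Moebius_function 0 w z) = z"
    using Moebius_function_compose w z by simp
  ultimately have le: "norm (f z - f w) / norm (1 - cnj (f w) * f z) \<le> norm (z - w) / norm (1 - cnj w * z)"
    by (simp add: g_def Moebius_function_simple norm_divide)
  define P where "P = (1 - (norm w)\<^sup>2) * (1 - (norm z)\<^sup>2)"
  define Q where "Q = (1 - (norm (f w))\<^sup>2) * (1 - (norm (f z))\<^sup>2)"
  have P: "P > 0" and Q: "Q > 0"
    using z w f norm_less_1_iff_sq by (auto simp: P_def Q_def)
  have "(norm (f z - f w))\<^sup>2 / (norm (1 - cnj (f w) * f z))\<^sup>2 \<le> (norm (z - w))\<^sup>2 / (norm (1 - cnj w * z))\<^sup>2"
    using power_mono[OF le, of 2] by (simp add: power_divide)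
  hence "(norm (f z - f w))\<^sup>2 / ((norm (f z - f w))\<^sup>2 + Q) \<le> (norm (z - w))\<^sup>2 / ((norm (z - w))\<^sup>2 + P)"
    unfolding norm_one_minus_cnj_mult_sq P_def Q_def by (simp add: norm_minus_commute)
  \<comment> \<open>After cross-multiplication the terms \<open>A * B\<close> cancel: comparing A /
    (A + Q) with B / (B + P) amounts to comparing A / Q with B / P.\<close>
  moreover have "A * P \<le> B * Q" if "A / (A + Q) \<le> B / (B + P)" "A \<ge> 0" "B \<ge> 0" for A B :: real
  proof -
    have "A + Q > 0" "B + P > 0" using that P Q by auto
    hence "A * (B + P) \<le> B * (A + Q)"
      using that(1) by (simp add: pos_divide_le_eq pos_le_divide_eq)
    thus ?thesis by (simp add: algebra_simps)
  qed
  ultimately have "(norm (f z - f w))\<^sup>2 * P \<le> (norm (z - w))\<^sup>2 * Q" by auto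
  thus ?thesis unfolding P_def Q_def by (simp add: mult.commute)
qed

text \<open>Conjugation with the Cayley transform at 1; the factor 4 of
  \<open>cayley_half_plane_invariant\<close> occurs on both sides and drops out.\<close>

lemma Schwarz_Pick_half_plane:
  assumes hol: "F holomorphic_on right_half_plane" and F: "\<And>u. Re u > 0 \<Longrightarrow> Re (F u) > 0"
    and u: "Re u > 0" and v: "Re v > 0"
  shows "(norm (F u - F v))\<^sup>2 * (Re u * Re v) \<le> (norm (u - v))\<^sup>2 * (Re (F u) * Re (F v))"
proof -
  define f where "f = cayley_inv 1 \<circ> F \<circ> cayley 1"
  define z where "z = cayley_inv 1 u"
  define w where "w = cayley_inv 1 v"
  have c: "cayley 1 (cayley_inv 1 x) = x" if "Re x > 0" for x
    using that by (intro cayley_cayley_inv) auto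
  have z: "norm z < 1" "cayley 1 z = u" and w: "norm w < 1" "cayley 1 w = v"
    using u v c norm_cayley_inv_less_1[of 1] by (auto simp: z_def w_def)
  have "f holomorphic_on ball 0 1"
    unfolding f_def using F Re_cayley_pos[of 1]
    by (intro holomorphic_on_compose_gen[OF cayley_holomorphic
          holomorphic_on_compose_gen[OF hol cayley_inv_holomorphic]]) auto
  moreover have f1: "norm (f x) < 1" if "norm x < 1" for x
    unfolding f_def using that F Re_cayley_pos[of 1] norm_cayley_inv_less_1[of 1] by auto
  ultimately have SP: "(norm (f z - f w))\<^sup>2 * ((1 - (norm z)\<^sup>2) * (1 - (norm w)\<^sup>2))
       \<le> (norm (z - w))\<^sup>2 * ((1 - (norm (f z))\<^sup>2) * (1 - (norm (f w))\<^sup>2))"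
    using z w by (intro Schwarz_Pick_disk) auto
  have fz: "cayley 1 (f z) = F u" "cayley 1 (f w) = F v"
    using z w F u v c by (auto simp: f_def)
  define P where "P = (1 - (norm z)\<^sup>2) * (1 - (norm w)\<^sup>2)"
  define Q where "Q = (1 - (norm (f z))\<^sup>2) * (1 - (norm (f w))\<^sup>2)"
  have P: "P > 0" and Q: "Q > 0"
    using z w f1 norm_less_1_iff_sq by (auto simp: P_def Q_def)
  define R where "R = Re u * Re v"
  define S where "S = Re (F u) * Re (F v)"
  have R: "R > 0" and S: "S > 0" using u v F by (auto simp: R_def S_def)
  have 1: "(norm (u - v))\<^sup>2 * P = 4 * (norm (z - w))\<^sup>2 * R"
    using cayley_half_plane_invariant[of 1 z w] z w by (simp add: P_def R_def)
  have 2: "(norm (F u - F v))\<^sup>2 * Q = 4 * (norm (f z - f w))\<^sup>2 * S"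
    using cayley_half_plane_invariant[of 1 "f z" "f w"] fz f1 z w by (simp add: Q_def S_def)
  have "(norm (F u - F v))\<^sup>2 = 4 * (norm (f z - f w))\<^sup>2 * S / Q" "(norm (u - v))\<^sup>2 = 4 * (norm (z - w))\<^sup>2 * R / P"
    using 1 2 P Q by (simp_all add: field_simps)
  moreover have "(norm (f z - f w))\<^sup>2 / Q \<le> (norm (z - w))\<^sup>2 / P"
    using SP[folded P_def Q_def] P Q by (simp add: pos_divide_le_eq pos_le_divide_eq mult.commute mult.left_commute)
  hence "4 * R * S * ((norm (f z - f w))\<^sup>2 / Q) \<le> 4 * R * S * ((norm (z - w))\<^sup>2 / P)"
    using R S by (intro mult_left_mono) auto
  ultimately show ?thesis unfolding R_def[symmetric] S_def[symmetric]
    by (simp add: field_simps)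
qed

text \<open>Divide the two-point inequality by |v - u|^2 and let \<open>v\<close> tend to
  \<open>u\<close>.\<close>

lemma Schwarz_Pick_half_plane_deriv:
  assumes hol: "F holomorphic_on right_half_plane" and F: "\<And>u. Re u > 0 \<Longrightarrow> Re (F u) > 0"
    and u: "Re u > 0"
  shows "norm (deriv F u) * Re u \<le> Re (F u)"
proof -
  have op: "open right_half_plane" by (rule open_halfspace_Re_gt)
  have d: "(F has_field_derivative deriv F u) (at u)"
    using holomorphic_derivI[OF hol op] u by auto
  hence "((\<lambda>v. (F v - F u) / (v - u)) \<longlongrightarrow> deriv F u) (at u)"
    by (simp add: has_field_derivative_iff)
  hence l1: "((\<lambda>v. (norm ((F v - F u) / (v - u)))\<^sup>2 * (Re v * Re u)) \<longlongrightarrow> (norm (deriv F u))\<^sup>2 * (Re u * Re u)) (at u)"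
    by (intro tendsto_intros)
  have "F \<midarrow>u\<rightarrow> F u" using d DERIV_isCont isCont_def by blast
  hence l2: "((\<lambda>v. Re (F v) * Re (F u)) \<longlongrightarrow> Re (F u) * Re (F u)) (at u)"
    by (intro tendsto_intros)
  have "\<forall>\<^sub>F v in at u. v \<in> right_half_plane" 
    using u by (intro eventually_at_in_open') (auto simp: op)
  moreover have "\<forall>\<^sub>F v in at u. v \<noteq> u" by (simp add: eventually_neq_at_within)
  ultimately have "\<forall>\<^sub>F v in at u. (norm ((F v - F u) / (v - u)))\<^sup>2 * (Re v * Re u) \<le> Re (F v) * Re (F u)"
  proof eventually_elim
    case (elim v)
    thus ?case using Schwarz_Pick_half_plane[OF hol F, of v u] u
      by (simp add: norm_divide power_divide divide_simps mult_ac)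
  qed
  from tendsto_le[OF _ l2 l1 this]
  have "(norm (deriv F u))\<^sup>2 * (Re u * Re u) \<le> Re (F u) * Re (F u)" by simp
  hence "(norm (deriv F u) * Re u)\<^sup>2 \<le> (Re (F u))\<^sup>2" by (simp add: power2_eq_square mult_ac)
  thus ?thesis by (rule power2_le_imp_le) (use F[OF u] in simp)
qed

text \<open>Follows by adding the product of all four factors 1 - |.|^2 to both sides of
  \<open>Schwarz_Pick_disk\<close>.\<close>

lemma Schwarz_Pick_disk':
  assumes hol: "f holomorphic_on ball 0 1" and f: "\<And>z. norm z < 1 \<Longrightarrow> norm (f z) < 1"
    and z: "norm z < 1" and w: "norm w < 1"
  shows "(norm (1 - cnj (f z) * f w))\<^sup>2 * ((1 - (norm z)\<^sup>2) * (1 - (norm w)\<^sup>2))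
       \<le> (norm (1 - cnj z * w))\<^sup>2 * ((1 - (norm (f z))\<^sup>2) * (1 - (norm (f w))\<^sup>2))"
  using Schwarz_Pick_disk[OF assms] unfolding norm_one_minus_cnj_mult_sq by (simp add: algebra_simps)

section \<open>Julia's lemma and the angular derivative at infinity\<close>

text \<open>Schwarz-Pick for the pair \<open>z\<close>, \<open>x k\<close> contains the quotient of
  boundary distances of \<open>f (x k)\<close> and \<open>x k\<close>, at most \<open>A\<close>. In
  the limit only \<open>\<zeta>\<close> remains.\<close>

lemma Julia_lemma:
  assumes hol: "f holomorphic_on ball 0 1" and f: "\<And>z. norm z < 1 \<Longrightarrow> norm (f z) < 1"
    and zeta: "norm \<zeta> = 1"
    and x: "\<And>k. norm (x k) < 1" "x \<longlonglongrightarrow> \<zeta>" "(\<lambda>k. f (x k)) \<longlonglongrightarrow> \<zeta>"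
    and A: "\<And>k. 1 - (norm (f (x k)))\<^sup>2 \<le> A * (1 - (norm (x k))\<^sup>2)"
    and z: "norm z < 1"
  shows "Re (cayley \<zeta> z) \<le> A * Re (cayley \<zeta> (f z))"
proof -
  define p where "p = 1 - (norm z)\<^sup>2"
  define q where "q = 1 - (norm (f z))\<^sup>2"
  have p: "p > 0" and q: "q > 0" using z f norm_less_1_iff_sq by (auto simp: p_def q_def)
  have le: "(norm (1 - cnj (f z) * f (x k)))\<^sup>2 * p \<le> (norm (1 - cnj z * x k))\<^sup>2 * (A * q)" for k
  proof -
    define r where "r = 1 - (norm (x k))\<^sup>2"
    have r: "r > 0" using x(1) norm_less_1_iff_sq by (auto simp: r_def)
    have "(norm (1 - cnj (f z) * f (x k)))\<^sup>2 * (p * r) \<le> (norm (1 - cnj z * x k))\<^sup>2 * (q * (1 - (norm (f (x k)))\<^sup>2))"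
      using Schwarz_Pick_disk'[OF hol f z x(1)[of k]] by (simp add: p_def q_def r_def)
    also have "\<dots> \<le> (norm (1 - cnj z * x k))\<^sup>2 * (q * (A * r))"
      using A[of k] q by (intro mult_left_mono) (auto simp: r_def)
    finally have "((norm (1 - cnj (f z) * f (x k)))\<^sup>2 * p) * r \<le> ((norm (1 - cnj z * x k))\<^sup>2 * (A * q)) * r"
      by (simp add: mult_ac)
    thus ?thesis using r by simp
  qed
  have "(norm (1 - cnj (f z) * \<zeta>))\<^sup>2 * p \<le> (norm (1 - cnj z * \<zeta>))\<^sup>2 * (A * q)"
    by (rule LIMSEQ_le[of "\<lambda>k. (norm (1 - cnj (f z) * f (x k)))\<^sup>2 * p" _
              "\<lambda>k. (norm (1 - cnj z * x k))\<^sup>2 * (A * q)"])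
       (use le in \<open>auto intro!: tendsto_intros x(2,3)\<close>)
  \<comment> \<open>As \<open>norm \<zeta> = 1\<close>, the product term of the identity vanishes
    and |1 - cnj z \<zeta>| = |z - \<zeta>|.\<close>
  hence "(norm (\<zeta> - f z))\<^sup>2 * p \<le> (norm (\<zeta> - z))\<^sup>2 * (A * q)"
    unfolding norm_one_minus_cnj_mult_sq using zeta by (simp add: norm_minus_commute)
  moreover have "(norm (\<zeta> - f z))\<^sup>2 > 0" "(norm (\<zeta> - z))\<^sup>2 > 0" using zeta f[OF z] z by auto
  ultimately show ?thesis
    unfolding Re_cayley[OF zeta] p_def[symmetric] q_def[symmetric]
    by (simp add: pos_divide_le_eq pos_le_divide_eq mult_ac)
qed

text \<open>The constant is the infimum of Re F / Re. That it is nearly attained feeds the sector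
  asymptotics; that it is maximal allows comparison with constants from Julia's lemma.\<close>

lemma best_half_plane_constant:
  fixes F :: "complex \<Rightarrow> complex"
  assumes F: "\<And>u. Re u > 0 \<Longrightarrow> Re (F u) > 0"
  obtains c :: real where "c \<ge> 0" "\<And>u. Re u > 0 \<Longrightarrow> c * Re u \<le> Re (F u)"
    "\<And>\<epsilon>. \<epsilon> > 0 \<Longrightarrow> \<exists>v. Re v > 0 \<and> Re (F v) < (c + \<epsilon>) * Re v"
    "\<And>c'. (\<And>u. Re u > 0 \<Longrightarrow> c' * Re u \<le> Re (F u)) \<Longrightarrow> c' \<le> c"
proof
  define S where "S = (\<lambda>u. Re (F u) / Re u) ` right_half_plane"
  have ne: "S \<noteq> {}" by (auto simp: S_def intro: exI[of _ 1])
  have nn: "s \<ge> 0" if "s \<in> S" for s using that F by (fastforce simp: S_def intro!: divide_nonneg_pos)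
  have bdd: "bdd_below S" using nn by (intro bdd_belowI[of _ 0])
  show "Inf S \<ge> 0" using nn ne by (intro cInf_greatest)
  show "Inf S * Re u \<le> Re (F u)" if "Re u > 0" for u
  proof -
    have "Inf S \<le> Re (F u) / Re u" using that bdd by (intro cInf_lower) (auto simp: S_def)
    thus ?thesis using that by (simp add: pos_le_divide_eq)
  qed
  show "\<exists>v. Re v > 0 \<and> Re (F v) < (Inf S + \<epsilon>) * Re v" if "\<epsilon> > 0" for \<epsilon>
  proof -
    obtain s where "s \<in> S" "s < Inf S + \<epsilon>" using cInf_lessD[OF ne, of "Inf S + \<epsilon>"] \<open>\<epsilon> > 0\<close> by auto
    thus ?thesis by (auto simp: S_def pos_divide_less_eq)
  qed
  show "c' \<le> Inf S" if "\<And>u. Re u > 0 \<Longrightarrow> c' * Re u \<le> Re (F u)" for c'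
    using ne that by (intro cInf_greatest) (auto simp: S_def pos_le_divide_eq)
qed

text \<open>With \<open>q u = F u - (c - \<delta>) u\<close>,
  the Schwarz--Pick lemma transports the smallness of \<open>Re q / Re\<close> at a single point \<open>v\<close> to
  the whole sector near infinity.\<close>
lemma Julia_Wolff_Caratheodory_half_plane:
  assumes hol: "F holomorphic_on right_half_plane" and F: "\<And>u. Re u > 0 \<Longrightarrow> Re (F u) > 0"
    and c: "\<And>u. Re u > 0 \<Longrightarrow> c * Re u \<le> Re (F u)"
    and best: "\<And>\<epsilon>. \<epsilon> > 0 \<Longrightarrow> \<exists>v. Re v > 0 \<and> Re (F v) < (c + \<epsilon>) * Re v"
    and eps: "\<epsilon> > 0" and M: "M > 0"
  obtains R where "R > 0"
    "\<And>u. Re u > 0 \<Longrightarrow> norm u \<le> M * Re u \<Longrightarrow> norm u \<ge> R \<Longrightarrow> norm (F u - c * u) \<le> \<epsilon> * norm u"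
    "\<And>u. Re u > 0 \<Longrightarrow> norm u \<le> M * Re u \<Longrightarrow> norm u \<ge> R \<Longrightarrow> norm (deriv F u - c) \<le> \<epsilon>"
proof -
  \<comment> \<open>The sum of the two factors of \<open>\<delta>\<close> that arise at the end, one
    for \<open>F u - c * u\<close> and one for the derivative, so that a single
    \<open>\<delta>\<close> serves both.\<close>
  define K where "K = (8 * M + 2) + ((8 * M + 1) * M + 1)"
  define \<delta> where "\<delta> = \<epsilon> / K"
  have K: "K > 0" using M by (simp add: K_def add_pos_pos)
  have d: "\<delta> > 0" using eps K by (simp add: \<delta>_def)
  have dK: "\<delta> * K = \<epsilon>" using K by (simp add: \<delta>_def)
  have dK1: "\<delta> * (8 * M + 2) \<le> \<epsilon>" and dK2: "\<delta> * ((8 * M + 1) * M + 1) \<le> \<epsilon>"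
    unfolding dK[symmetric] K_def using d M by (auto intro!: mult_left_mono)
  \<comment> \<open>Subtracting c - \<delta> rather than c keeps Re q strictly positive, so that
    Schwarz-Pick applies to \<open>q\<close> itself.\<close>
  define q where "q = (\<lambda>u. F u - of_real (c - \<delta>) * u)"
  have qhol: "q holomorphic_on right_half_plane" unfolding q_def by (intro holomorphic_intros hol)
  have qpos: "Re (q u) > 0" if "Re u > 0" for u
  proof -
    have "c * Re u \<le> Re (F u)" "\<delta> * Re u > 0" using c d that by auto
    thus ?thesis by (simp add: q_def algebra_simps)
  qed
  obtain v where v: "Re v > 0" "Re (F v) < (c + \<delta>) * Re v" using best[OF d] by blast
  have qv: "Re (q v) \<le> 2 * \<delta> * Re v" using v by (simp add: q_def algebra_simps)
  define B where "B = norm (q v)"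
  have B: "B \<ge> 0" by (simp add: B_def)
  \<comment> \<open>Beyond this radius |u - v| \<le> 2 |u|, and the fixed error 2 B is absorbed into
    \<delta> |u|.\<close>
  define R where "R = norm v + 2 * B / \<delta> + 1"
  have "2 * B / \<delta> \<ge> 0" "norm v \<ge> 0" using B d by auto
  hence R: "R > 0" "norm v \<le> R" "2 * B / \<delta> \<le> R" unfolding R_def by linarith+
  from R(3) d have R3: "2 * B \<le> \<delta> * R" by (simp add: field_simps)
  have main: "norm (q u) \<le> (8 * M + 1) * \<delta> * norm u"
    if u: "Re u > 0" "norm u \<le> M * Re u" "norm u \<ge> R" for u
  proof -
    have nu: "norm u > 0" using u by auto
    define X where "X = norm (q u - q v)"
    define Y where "Y = 8 * \<delta> * M * norm u"
    have Y: "Y \<ge> 0" using d M by (simp add: Y_def)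
    have "X\<^sup>2 * Re u * Re v \<le> (norm (u - v))\<^sup>2 * Re (q u) * Re (q v)"
      using Schwarz_Pick_half_plane[OF qhol qpos u(1) v(1)] by (simp add: X_def mult_ac)
    also have "\<dots> \<le> (2 * norm u)\<^sup>2 * norm (q u) * (2 * \<delta> * Re v)"
    proof (intro mult_mono)
      show "(norm (u - v))\<^sup>2 \<le> (2 * norm u)\<^sup>2"
        using norm_triangle_ineq4[of u v] u R by (intro power_mono) auto
    qed (use qv qpos u v d complex_Re_le_cmod in \<open>auto simp: less_imp_le\<close>)
    finally have "(X\<^sup>2 * Re u) * Re v \<le> (8 * \<delta> * (norm u)\<^sup>2 * norm (q u)) * Re v"
      by (simp add: power2_eq_square mult_ac)
    hence "X\<^sup>2 * Re u \<le> 8 * \<delta> * (norm u)\<^sup>2 * norm (q u)" using v by simp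
    hence "M * (X\<^sup>2 * Re u) \<le> M * (8 * \<delta> * (norm u)\<^sup>2 * norm (q u))"
      using M by (intro mult_left_mono) auto
    moreover have "X\<^sup>2 * norm u \<le> X\<^sup>2 * (M * Re u)" using u(2) by (intro mult_left_mono) auto
    moreover have "X\<^sup>2 * (M * Re u) = M * (X\<^sup>2 * Re u)" by simp
    ultimately have "X\<^sup>2 * norm u \<le> M * (8 * \<delta> * (norm u)\<^sup>2 * norm (q u))" by linarith
    hence "X\<^sup>2 * norm u \<le> (Y * norm (q u)) * norm u" by (simp add: Y_def power2_eq_square mult_ac)
    hence "X\<^sup>2 \<le> Y * norm (q u)" using nu by simp
    also have "\<dots> \<le> Y * (X + B)"
      using Y norm_triangle_ineq[of "q u - q v" "q v"] by (intro mult_left_mono) (auto simp: X_def B_def)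
    finally have XY: "X\<^sup>2 \<le> Y * (X + B)" .
    \<comment> \<open>A larger X would give X^2 > (Y + B) X \<ge> Y X + B Y, against the quadratic
      inequality \<open>XY\<close>.\<close>
    have "X \<le> Y + B"
    proof (rule ccontr)
      assume "\<not> X \<le> Y + B"
      hence 1: "X > Y + B" by simp
      hence "X\<^sup>2 > (Y + B) * X" using Y B by (simp add: power2_eq_square)
      moreover have "B * X \<ge> B * Y" using 1 B by (intro mult_left_mono) auto
      ultimately show False using XY by (simp add: algebra_simps)
    qed
    hence "norm (q u) \<le> Y + 2 * B" using norm_triangle_ineq[of "q u - q v" "q v"] by (simp add: X_def B_def)
    also have "2 * B \<le> \<delta> * norm u" using R3 u(3) d by (meson mult_left_mono order_trans less_imp_le)
    finally show ?thesis by (simp add: Y_def algebra_simps)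
  qed
  show ?thesis
  proof (rule that[OF R(1)])
    fix u assume u: "Re u > 0" "norm u \<le> M * Re u" "norm u \<ge> R"
    have nu: "norm u > 0" using u by auto
    have "F u - c * u = q u - of_real \<delta> * u" by (simp add: q_def algebra_simps)
    hence "norm (F u - c * u) \<le> norm (q u) + \<delta> * norm u"
      using norm_triangle_ineq4[of "q u" "of_real \<delta> * u"] d by (simp add: norm_mult)
    also have "\<dots> \<le> (\<delta> * (8 * M + 2)) * norm u" using main[OF u] by (simp add: algebra_simps)
    also have "\<dots> \<le> \<epsilon> * norm u" using dK1 by (intro mult_right_mono) auto
    finally show "norm (F u - c * u) \<le> \<epsilon> * norm u" .
    \<comment> \<open>Applied to \<open>q\<close> rather than \<open>F\<close>, the derivative
      estimate inherits the smallness of \<open>q\<close> on the sector.\<close>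
    have "norm (deriv q u) * Re u \<le> Re (q u)" by (rule Schwarz_Pick_half_plane_deriv[OF qhol qpos u(1)])
    also have "\<dots> \<le> norm (q u)" by (rule complex_Re_le_cmod)
    also have "\<dots> \<le> (8 * M + 1) * \<delta> * norm u" by (rule main[OF u])
    also have "\<dots> \<le> (8 * M + 1) * \<delta> * (M * Re u)" using M d by (intro mult_left_mono u(2)) auto
    finally have "norm (deriv q u) * Re u \<le> ((8 * M + 1) * \<delta> * M) * Re u" by (simp add: mult_ac)
    hence dq: "norm (deriv q u) \<le> (8 * M + 1) * \<delta> * M" using u(1) by simp
    have "(F has_field_derivative deriv F u) (at u)"
      using holomorphic_derivI[OF hol open_halfspace_Re_gt] u by auto
    hence "(q has_field_derivative (deriv F u - of_real (c - \<delta>))) (at u)"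
      unfolding q_def by (auto intro!: derivative_eq_intros)
    hence "deriv F u - c = deriv q u - of_real \<delta>" by (simp add: DERIV_imp_deriv)
    hence "norm (deriv F u - c) \<le> norm (deriv q u) + \<delta>"
      using norm_triangle_ineq4[of "deriv q u" "of_real \<delta>"] d by simp
    also have "\<dots> \<le> \<delta> * ((8 * M + 1) * M + 1)" using dq by (simp add: algebra_simps)
    also have "\<dots> \<le> \<epsilon>" by (rule dK2)
    finally show "norm (deriv F u - c) \<le> \<epsilon>" .
  qed
qed

subsection \<open>Cluster points of sequences with vanishing steps\<close>

definition cluster_points :: "(nat \<Rightarrow> 'a::metric_space) \<Rightarrow> 'a set" where
  "cluster_points x = {l. \<forall>e>0. \<exists>\<^sub>F n in sequentially. dist (x n) l < e}"

lemma cluster_points_subseq: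
  assumes "l \<in> cluster_points x"
  obtains r :: "nat \<Rightarrow> nat" where "strict_mono r" "(x \<circ> r) \<longlonglongrightarrow> l"
proof -
  have "\<exists>m>n. dist (x m) l < 1 / real (Suc k)" for n k
    using assms unfolding cluster_points_def frequently_sequentially
    by (auto dest!: spec[of _ "1 / real (Suc k)"] spec[of _ "Suc n"] simp: Suc_le_eq)
  then obtain f where f: "\<And>n k. f n k > n" "\<And>n k. dist (x (f n k)) l < 1 / real (Suc k)" by metis
  define r where "r = rec_nat (f 0 0) (\<lambda>k n. f n (Suc k))"
  have rS: "r (Suc k) = f (r k) (Suc k)" "r 0 = f 0 0" for k by (simp_all add: r_def)
  have "strict_mono r" by (simp add: strict_mono_Suc_iff rS f)
  moreover have "dist (x (r k)) l < inverse (real (Suc k))" for k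
    using f(2) by (cases k) (simp_all only: rS inverse_eq_divide)
  hence "(\<lambda>k. dist (x (r k)) l) \<longlonglongrightarrow> 0"
    by (intro tendsto_sandwich[OF _ _ tendsto_const LIMSEQ_inverse_real_of_nat])
       (auto intro!: always_eventually less_imp_le)
  hence "(x \<circ> r) \<longlonglongrightarrow> l" by (subst tendsto_dist_iff) (simp add: comp_def)
  ultimately show ?thesis by (rule that)
qed

lemma cluster_pointsI_subseq:
  assumes "strict_mono (r :: nat \<Rightarrow> nat)" "(x \<circ> r) \<longlonglongrightarrow> l"
  shows "l \<in> cluster_points x"
  unfolding cluster_points_def frequently_sequentially
proof safe
  fix e :: real and N :: nat assume "e > 0"
  then obtain M where "dist (x (r n)) l < e" if "n \<ge> M" for n
    using assms(2) by (auto simp: lim_sequentially comp_def)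
  moreover have "r (max M N) \<ge> N" using seq_suble[OF assms(1), of "max M N"] by auto
  ultimately show "\<exists>n\<ge>N. dist (x n) l < e" by (metis max.cobounded1)
qed

lemma closed_cluster_points: "closed (cluster_points x)"
proof (subst closed_sequential_limits, safe)
  fix l y assume y: "\<forall>n. y n \<in> cluster_points x" "y \<longlonglongrightarrow> l"
  show "l \<in> cluster_points x" unfolding cluster_points_def
  proof safe
    fix e :: real assume e: "e > 0"
    obtain k where k: "dist (y k) l < e / 2" 
      using y(2) e by (metis half_gt_zero lim_sequentially order_refl)
    have "\<exists>\<^sub>F n in sequentially. dist (x n) (y k) < e / 2"
      using y(1) half_gt_zero[OF e] unfolding cluster_points_def by blast
    thus "\<exists>\<^sub>F n in sequentially. dist (x n) l < e"
    proof (rule frequently_elim1)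
      fix n assume "dist (x n) (y k) < e / 2"
      thus "dist (x n) l < e" using k dist_triangle[of "x n" l "y k"] by simp
    qed
  qed
qed

text \<open>Otherwise a subsequence keeps away from all cluster points, yet by boundedness it has a
  convergent subsequence, whose limit is one of them.\<close>

lemma eventually_near_cluster_points:
  fixes x :: "nat \<Rightarrow> 'a::heine_borel"
  assumes bdd: "bounded (range x)" and e: "e > 0"
  shows "\<forall>\<^sub>F n in sequentially. \<exists>l\<in>cluster_points x. dist (x n) l < e"
proof (rule ccontr)
  assume "\<not> ?thesis"
  hence "infinite {n. \<forall>l\<in>cluster_points x. \<not> dist (x n) l < e}"
    by (simp add: not_eventually frequently_sequentially infinite_nat_iff_unbounded_le) 
  then obtain r :: "nat \<Rightarrow> nat" where r: "strict_mono r" "\<And>n. r n \<in> {n. \<forall>l\<in>cluster_points x. \<not> dist (x n) l < e}"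
    using infinite_enumerate by blast
  have "bounded (range (x \<circ> r))" using bdd by (rule bounded_subset) auto
  then obtain l s where s: "strict_mono (s :: nat \<Rightarrow> nat)" "((x \<circ> r) \<circ> s) \<longlonglongrightarrow> l"
    using bounded_imp_convergent_subsequence by blast
  have "l \<in> cluster_points x"
    using cluster_pointsI_subseq[of "r \<circ> s" x l] strict_mono_o[OF r(1) s(1)] s(2) by (simp add: o_assoc)
  moreover obtain N where "dist (x (r (s N))) l < e"
    using s(2) e by (auto simp: lim_sequentially comp_def)
  ultimately show False using r(2) by blast
qed

lemma convergent_if_cluster_points_singleton:
  fixes x :: "nat \<Rightarrow> 'a::heine_borel"
  assumes "bounded (range x)" "cluster_points x \<subseteq> {l}"
  shows "x \<longlonglongrightarrow> l"
  unfolding tendsto_iff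
proof safe
  fix e :: real assume "e > 0"
  from eventually_near_cluster_points[OF assms(1) this]
  show "\<forall>\<^sub>F n in sequentially. dist (x n) l < e"
    by eventually_elim (use assms(2) in auto)
qed

text \<open>Two separated compact pieces of the cluster set have a positive distance d. A sequence
  that is finally close to their union and has small steps cannot cross the gap, though it must
  visit both pieces infinitely often.\<close>

lemma connected_cluster_points:
  fixes x :: "nat \<Rightarrow> 'a::heine_borel"
  assumes bdd: "bounded (range x)" and step: "(\<lambda>n. dist (x n) (x (Suc n))) \<longlonglongrightarrow> 0"
  shows "connected (cluster_points x)"
  unfolding connected_closed
proof (rule notI, elim exE conjE)
  fix A B assume A: "closed A" and B: "closed B" and cov: "cluster_points x \<subseteq> A \<union> B"
    and dis: "A \<inter> B \<inter> cluster_points x = {}"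
    and neA: "A \<inter> cluster_points x \<noteq> {}" and neB: "B \<inter> cluster_points x \<noteq> {}"
  have "bounded (cluster_points x)"
  proof -
    \<comment> \<open>\<open>undefined\<close> is just some centre; the type has no distinguished
      point.\<close>
    obtain C where C: "\<And>n. dist undefined (x n) \<le> C"
      using bdd by (auto simp: bounded_any_center[where a=undefined])
    have "dist undefined l \<le> C" if l: "l \<in> cluster_points x" for l
    proof -
      obtain r where "strict_mono r" "(x \<circ> r) \<longlonglongrightarrow> l" using cluster_points_subseq[OF l] by blast
      hence "(\<lambda>n. dist undefined (x (r n))) \<longlonglongrightarrow> dist undefined l"
        by (auto intro!: tendsto_intros simp: comp_def)
      thus ?thesis using C by (intro LIMSEQ_le_const2[of _ "dist undefined l"]) auto
    qed
    thus ?thesis by (auto simp: bounded_any_center[where a=undefined])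
  qed
  hence "compact (A \<inter> cluster_points x)" "compact (B \<inter> cluster_points x)"
    using A B closed_cluster_points by (auto intro!: closed_Int simp: compact_eq_bounded_closed intro: bounded_subset)
  moreover have "(A \<inter> cluster_points x) \<inter> (B \<inter> cluster_points x) = {}" using dis by auto
  ultimately obtain d where d: "d > 0"
    "\<And>a b. a \<in> A \<inter> cluster_points x \<Longrightarrow> b \<in> B \<inter> cluster_points x \<Longrightarrow> d \<le> dist a b"
    using separate_compact_closed[OF _ compact_imp_closed] by (metis (no_types, lifting))
  \<comment> \<open>With d / 3 the path from a point of A through one step to a point of B has total
    length below d.\<close>
  define near where "near = (\<lambda>C n. \<exists>l\<in>C \<inter> cluster_points x. dist (x n) l < d / 3)"
  have "\<forall>\<^sub>F n in sequentially. dist (x n) (x (Suc n)) < d / 3"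
    using order_tendstoD(2)[OF step, of "d / 3"] d by simp
  moreover have "\<forall>\<^sub>F n in sequentially. near A n \<or> near B n"
    using eventually_near_cluster_points[OF bdd, of "d / 3"] d cov
    by (force simp: near_def elim!: eventually_mono)
  ultimately obtain N where N: "\<And>n. n \<ge> N \<Longrightarrow> dist (x n) (x (Suc n)) < d / 3"
      "\<And>n. n \<ge> N \<Longrightarrow> near A n \<or> near B n"
    unfolding eventually_sequentially by (metis le_cases order_trans)
  \<comment> \<open>The case \<open>n = m\<close> says that no term is near both pieces, the other
    case that no step leads from A to B.\<close>
  have excl: False if "near A n" "near B m" "n = m \<or> m = Suc n \<and> n \<ge> N" for n m
  proof -
    obtain a b where a: "a \<in> A \<inter> cluster_points x" "dist (x n) a < d / 3"
      and b: "b \<in> B \<inter> cluster_points x" "dist (x m) b < d / 3"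
      using \<open>near A n\<close> \<open>near B m\<close> unfolding near_def by blast
    have "dist (x n) (x m) < d / 3" using that(3) N(1) d(1) by auto
    moreover have "dist a b \<le> dist a (x n) + dist (x n) (x m) + dist (x m) b"
      using dist_triangle[of a b "x n"] dist_triangle[of "x n" b "x m"] by linarith
    moreover have "dist a (x n) < d / 3" using a(2) by (simp add: dist_commute)
    ultimately show False using d(2)[OF a(1) b(1)] b(2) by linarith
  qed
  have freq: "\<exists>n\<ge>M. near C n" if "C \<inter> cluster_points x \<noteq> {}" for C M
  proof -
    obtain l where l: "l \<in> C \<inter> cluster_points x" using \<open>C \<inter> cluster_points x \<noteq> {}\<close> by blast
    hence "\<forall>e>0. \<forall>N. \<exists>n\<ge>N. dist (x n) l < e" by (simp add: cluster_points_def frequently_sequentially)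
    from this[rule_format, of "d / 3" M] have "\<exists>n\<ge>M. dist (x n) l < d / 3" using d(1) by simp
    thus ?thesis using l unfolding near_def by blast
  qed
  obtain n where n: "n \<ge> N" "near A n" using freq[OF neA] by blast
  have "near A m" if "m \<ge> n" for m
    using that
  proof (induction m rule: dec_induct)
    case (step m)
    thus ?case using N(2)[of "Suc m"] excl[of m "Suc m"] n(1) by auto
  qed (fact n(2))
  moreover obtain m where "m \<ge> n" "near B m" using freq[OF neB] by blast
  ultimately show False using excl by blast
qed

section \<open>Arcs of cluster points and functions with zero boundary values on an arc\<close>

text \<open>If a point of the circle is missing, the argument is continuous on the rest, and a
  connected set of arguments with two elements contains an interval.\<close>

lemma connected_subset_circle_contains_arc:
  assumes conn: "connected L" and L: "L \<subseteq> sphere 0 1" and pq: "p \<in> L" "q \<in> L" "p \<noteq> q"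
  obtains s t :: real where "s < t" "\<And>\<theta>. \<theta> \<in> {s..t} \<Longrightarrow> cis \<theta> \<in> L"
proof (cases "L = sphere 0 1")
  case True
  thus ?thesis by (intro that[of 0 1]) auto
next
  case False
  then obtain c where "c \<in> sphere 0 1" "c \<notin> L" using L by blast
  hence c: "norm c = 1" "c \<notin> L" by auto
  \<comment> \<open>Division by \<open>- c\<close> rotates the missing point onto -1, the only point
    of the circle on the branch cut of \<open>Arg\<close>.\<close>
  define g where "g = (\<lambda>z. Arg (- z / c))"
  have c0: "c \<noteq> 0" using c by auto
  have cis_g: "cis (g z) = - z / c" if "z \<in> L" for z
  proof -
    have "norm z = 1" using that L by auto
    hence "norm (- z / c) = 1" using c by (simp add: norm_divide)
    moreover from this have "- z / c \<noteq> 0" by auto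
    ultimately show ?thesis unfolding g_def by (simp add: cis_Arg sgn_eq del: norm_divide)
  qed
  have "- z / c \<notin> \<real>\<^sub>\<le>\<^sub>0" if "z \<in> L" for z
  proof
    assume "- z / c \<in> \<real>\<^sub>\<le>\<^sub>0"
    then obtain x where x: "- z / c = of_real x" "x \<le> 0" by (rule nonpos_Reals_cases)
    have "norm z = 1" using that L by auto
    hence "norm (- z / c) = 1" using c by (simp add: norm_divide)
    hence "\<bar>x\<bar> = 1" unfolding x(1) norm_of_real .
    hence "x = -1" using x by simp
    hence "z = c" using x(1) c0 by (simp add: field_simps)
    thus False using that c by simp
  qed
  hence im: "(\<lambda>z. - z / c) ` L \<subseteq> - \<real>\<^sub>\<le>\<^sub>0" by blast
  have cArg: "continuous_on (- \<real>\<^sub>\<le>\<^sub>0) Arg"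
    by (intro continuous_at_imp_continuous_on ballI continuous_at_Arg) auto
  have "continuous_on L (\<lambda>z. - z / c)"
    using c0 by (intro continuous_intros) auto
  hence "continuous_on L g"
    unfolding g_def by (rule continuous_on_compose2[OF cArg _ im])
  hence conn': "connected (g ` L)" using conn by (rule connected_continuous_image)
  have "g p \<noteq> g q"
  proof
    assume "g p = g q"
    hence "- p / c = - q / c" using cis_g pq by metis
    thus False using pq c0 by simp
  qed
  define s where "s = min (g p) (g q)"
  define t where "t = max (g p) (g q)"
  have st: "s < t" using \<open>g p \<noteq> g q\<close> by (auto simp: s_def t_def)
  have "{s..t} \<subseteq> g ` L"
    using pq by (intro connected_contains_Icc[OF conn']) (auto simp: s_def t_def min_def max_def)
  hence *: "- c * cis \<theta> \<in> L" if "\<theta> \<in> {s..t}" for \<theta>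
    using that cis_g c0 by (force simp: image_iff subset_iff)
  have cA: "- c = cis (Arg (- c))" using c c0 by (simp add: cis_Arg sgn_eq)
  show ?thesis
  proof (rule that)
    show "s + Arg (- c) < t + Arg (- c)" using st by simp
    fix \<theta> assume "\<theta> \<in> {s + Arg (- c)..t + Arg (- c)}"
    hence "cis (Arg (- c)) * cis (\<theta> - Arg (- c)) \<in> L"
      using *[of "\<theta> - Arg (- c)"] cA by auto
    thus "cis \<theta> \<in> L" by (simp add: cis_mult)
  qed
qed

text \<open>The product of finitely many rotated copies of \<open>g\<close> tends to zero along the whole circle.\<close>
lemma vanishing_on_arc_imp_zero:
  assumes hol: "g holomorphic_on ball 0 1" and bd: "\<And>z. norm z < 1 \<Longrightarrow> norm (g z) \<le> B"
    and st: "s < t" and arc: "\<And>r \<theta>. 0 < r \<Longrightarrow> r < 1 \<Longrightarrow> \<theta> \<in> {s..t} \<Longrightarrow> norm (g (of_real r * cis \<theta>)) \<le> \<eta> r"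
    and lim: "(\<eta> \<longlongrightarrow> 0) (at_left 1)" and z: "norm z < 1"
  shows "g z = 0"
proof (rule ccontr)
  assume nz: "g z \<noteq> 0"
  \<comment> \<open>Enough rotations that their spacing 2 pi / N fits into the arc: some rotation
    carries any given point of a circle into the sector over it.\<close>
  obtain N :: nat where N: "2 * pi / (t - s) < real N" using reals_Archimedean2 by blast
  have "2 * pi / (t - s) > 0" using st by simp
  hence N0: "N > 0" using N by (cases N) auto
  have Nst: "2 * pi / real N \<le> t - s" using N N0 st by (simp add: field_simps)
  define \<rho> where "\<rho> = (\<lambda>k::nat. cis (2 * pi * real k / real N))"
  have [simp]: "norm (\<rho> k) = 1" for k by (simp add: \<rho>_def)
  define G where "G = (\<lambda>z. \<Prod>k<N. g (\<rho> k * z))"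
  have Ghol: "G holomorphic_on ball 0 1"
    unfolding G_def using hol
    by (intro holomorphic_intros holomorphic_on_compose_gen[OF _ hol, unfolded comp_def])
       (auto simp: norm_mult)
  have B0: "B \<ge> 0" using order_trans[OF norm_ge_zero bd[of 0]] by simp
  have circ: "norm (G w) \<le> \<eta> (norm w) * B ^ (N - 1)" if w: "0 < norm w" "norm w < 1" for w
  proof -
    define \<alpha> where "\<alpha> = Arg w"
    have w_eq: "w = of_real (norm w) * cis \<alpha>"
      using rcis_cmod_Arg[of w] by (simp add: rcis_def \<alpha>_def)
    \<comment> \<open>The least number of rotations by 2 pi / N that brings the angle to at least s,
      hence into {s..t}. It may be negative or large, so it is reduced modulo N to index a factor of
      \<open>G\<close>.\<close>
    define j where "j = \<lceil>(s - \<alpha>) * real N / (2 * pi)\<rceil>"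
    define k where "k = nat (j mod int N)"
    have kN: "k < N" using N0 by (simp add: k_def nat_less_iff)
    have "int k = j mod int N" using N0 by (simp add: k_def)
    hence "j = int k + int N * (j div int N)" by simp
    hence "real_of_int j = real k + real N * real_of_int (j div int N)"
      by (metis of_int_add of_int_mult of_int_of_nat_eq)
    hence "2 * pi * real_of_int j / real N = 2 * pi * real k / real N + 2 * pi * real_of_int (j div int N)"
      using N0 by (simp add: field_simps)
    hence "cis (2 * pi * real_of_int j / real N) = \<rho> k"
      by (simp add: \<rho>_def flip: cis_mult)
    hence eq: "\<rho> k * w = of_real (norm w) * cis (\<alpha> + 2 * pi * real_of_int j / real N)"
      by (subst w_eq) (simp flip: cis_mult)
    define h where "h = 2 * pi / real N"
    have h: "h > 0" using N0 by (simp add: h_def)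
    have jh: "2 * pi * real_of_int j / real N = h * real_of_int j" by (simp add: h_def)
    have "j = \<lceil>(s - \<alpha>) / h\<rceil>" by (simp add: j_def h_def)
    hence "(s - \<alpha>) / h \<le> real_of_int j" "real_of_int j < (s - \<alpha>) / h + 1" by linarith+
    hence "s \<le> \<alpha> + 2 * pi * real_of_int j / real N" "\<alpha> + 2 * pi * real_of_int j / real N \<le> s + 2 * pi / real N"
      using h unfolding jh h_def[symmetric] by (simp_all add: field_simps)
    hence "norm (g (\<rho> k * w)) \<le> \<eta> (norm w)"
      unfolding eq using w Nst by (intro arc) auto
    moreover have "(\<Prod>i\<in>{..<N} - {k}. norm (g (\<rho> i * w))) \<le> (\<Prod>i\<in>{..<N} - {k}. B)"
      using w by (intro prod_mono) (auto intro!: bd simp: norm_mult)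
    ultimately have "norm (g (\<rho> k * w)) * (\<Prod>i\<in>{..<N} - {k}. norm (g (\<rho> i * w))) \<le> \<eta> (norm w) * B ^ (N - 1)"
      using kN by (intro mult_mono prod_nonneg order_trans[OF norm_ge_zero]) auto
    thus ?thesis unfolding G_def using kN by (simp add: prod.remove[of "{..<N}" k] norm_mult prod_norm)
  qed
  have G0: "G w = 0" if w: "norm w < 1" for w
  proof -
    \<comment> \<open>The maximum modulus principle carries the bound inwards from the circle of
      radius r; letting r tend to 1 then kills \<open>G w\<close>.\<close>
    have "norm (G w) \<le> \<eta> r * B ^ (N - 1)" if r: "norm w < r" "r < 1" for r
    proof (rule maximum_modulus_frontier[of G "cball 0 r"])
      have "r > 0" using r norm_ge_zero[of w] by linarith
      thus "norm (G v) \<le> \<eta> r * B ^ (N - 1)" if "v \<in> frontier (cball 0 r)" for v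
        using circ[of v] that r by (auto simp: frontier_cball)
      have "cball 0 r \<subseteq> ball (0::complex) 1" using r by auto
      hence "G holomorphic_on cball 0 r" using Ghol holomorphic_on_subset by blast
      thus "G holomorphic_on interior (cball 0 r)" "continuous_on (closure (cball 0 r)) G"
        by (auto intro: holomorphic_on_subset[OF _ interior_subset] holomorphic_on_imp_continuous_on simp del: interior_cball)
    qed (use r in auto)
    hence "\<forall>\<^sub>F r in at_left 1. norm (G w) \<le> \<eta> r * B ^ (N - 1)"
      using w by (auto simp: eventually_at_left[of "norm w" 1])
    moreover have "((\<lambda>r. \<eta> r * B ^ (N - 1)) \<longlongrightarrow> 0 * B ^ (N - 1)) (at_left 1)"
      by (intro tendsto_intros lim)
    ultimately have "norm (G w) \<le> 0 * B ^ (N - 1)"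
      by (intro tendsto_lowerbound) auto
    thus ?thesis by simp
  qed
  \<comment> \<open>As \<open>g\<close> is not identically zero, it has no zeros in a small
    punctured disk. Rotations preserve the modulus, so no factor of \<open>G\<close> vanishes there
    either.\<close>
  have "\<exists>r>0. r \<le> 1 \<and> (\<forall>w. 0 < norm w \<and> norm w < r \<longrightarrow> g w \<noteq> 0)"
  proof (cases "g 0 = 0")
    case True
    obtain r where "0 < r" "ball 0 r \<subseteq> ball (0::complex) 1" "\<And>w. w \<in> ball 0 r - {0} \<Longrightarrow> g w \<noteq> 0"
      using isolated_zeros[OF hol _ _ _ True _ nz] z by auto
    thus ?thesis by (intro exI[of _ "min r 1"]) auto
  next
    case False
    have "isCont g 0"
      using holomorphic_on_imp_continuous_on[OF hol] by (simp add: continuous_on_eq_continuous_at)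
    then obtain r where "r > 0" "\<And>w. dist 0 w < r \<Longrightarrow> g w \<noteq> 0"
      using continuous_at_avoid[of 0 g 0] False by auto
    thus ?thesis by (intro exI[of _ "min r 1"]) auto
  qed
  then obtain r where r: "r > 0" "r \<le> 1" "\<And>w. 0 < norm w \<Longrightarrow> norm w < r \<Longrightarrow> g w \<noteq> 0" by blast
  have "G (of_real (r / 2)) \<noteq> 0"
  proof -
    have "g (\<rho> k * of_real (r / 2)) \<noteq> 0" for k
      using r(1,2) by (intro r(3)) (simp_all add: norm_mult \<rho>_def)
    thus ?thesis by (simp add: G_def)
  qed
  moreover have "G (of_real (r / 2)) = 0" using r by (intro G0) auto
  ultimately show False by simp
qed

subsection \<open>Backward orbits in the right half-plane\<close>

text \<open>Inserting Re v \<le> Re u + |u - v| turns the bound on the hyperbolic step into a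
  quadratic inequality for |u - v|: such steps are at most of the order of the real part.\<close>

lemma norm_diff_le_Re_if_bounded_step:
  assumes K: "K \<ge> 0" and x: "Re u > 0" and le: "(norm (u - v))\<^sup>2 \<le> K * (Re u * Re v)"
  shows "norm (u - v) \<le> (K + 1) * Re u" "Re v \<le> (K + 2) * Re u"
proof -
  define X where "X = norm (u - v)"
  have X0: "X \<ge> 0" by (simp add: X_def)
  have v: "Re v \<le> Re u + X" using complex_Re_le_cmod[of "v - u"] by (simp add: X_def norm_minus_commute)
  have "X\<^sup>2 \<le> K * (Re u * Re v)" using le by (simp add: X_def)
  also have "\<dots> \<le> K * (Re u * (Re u + X))" using K x v by (intro mult_left_mono) auto
  finally have 1: "X\<^sup>2 \<le> K * (Re u * (Re u + X))" .
  show 2: "norm (u - v) \<le> (K + 1) * Re u" unfolding X_def[symmetric]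
  proof (rule ccontr)
    assume "\<not> X \<le> (K + 1) * Re u"
    hence a: "X > (K + 1) * Re u" by simp
    have "(K + 1) * Re u > 0" using K x by (intro mult_pos_pos) auto
    hence Xp: "X > 0" using a by linarith
    have "X * X > ((K + 1) * Re u) * X" using a Xp by (intro mult_strict_right_mono)
    hence "X * X > Re u * X + K * (Re u * X)" by (simp add: algebra_simps)
    moreover have "Re u * X \<ge> Re u * ((K + 1) * Re u)" using a x by (intro mult_left_mono) auto
    hence "Re u * X \<ge> Re u * Re u + K * (Re u * Re u)" by (simp add: algebra_simps)
    moreover have "X * X \<le> K * (Re u * Re u) + K * (Re u * X)" using 1 by (simp add: power2_eq_square algebra_simps)
    moreover have "Re u * Re u > 0" using x by simp
    ultimately show False by linarith
  qed
  show "Re v \<le> (K + 2) * Re u" using 2 v by (simp add: X_def algebra_simps)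
qed

text \<open>The steps are dominated by a summable sequence, so their telescoping sum
  converges.\<close>

lemma Re_geometric_decay_imp_convergent:
  fixes U :: "nat \<Rightarrow> complex"
  assumes pos: "\<And>n. Re (U n) > 0" and C: "\<And>n. norm (U n - U (Suc n)) \<le> C * Re (U n)"
    and q: "q < 1" and decay: "\<And>n. n \<ge> N \<Longrightarrow> Re (U (Suc n)) \<le> q * Re (U n)"
  shows "convergent U"
proof -
  have "summable (\<lambda>n. Re (U n))"
    using q decay pos by (intro summable_ratio_test[of q N]) (auto simp: less_imp_le)
  hence "summable (\<lambda>n. C * Re (U n))" by (rule summable_mult)
  hence "summable (\<lambda>n. U (Suc n) - U n)"
    by (rule summable_comparison_test'[of _ 0]) (use C in \<open>simp add: norm_minus_commute\<close>)
  hence "convergent (\<lambda>n. (\<Sum>k<n. U (Suc k) - U k))" by (simp add: summable_iff_convergent)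
  hence "convergent (\<lambda>n. (\<Sum>k<n. U (Suc k) - U k) + U 0)"
    by (intro convergent_add convergent_const)
  thus ?thesis by (simp add: sum_lessThan_telescope)
qed

lemma convergent_not_at_infinity:
  fixes U :: "nat \<Rightarrow> 'a::real_normed_vector"
  shows "convergent U \<Longrightarrow> \<not> filterlim U at_infinity sequentially"
  using not_tendsto_and_filterlim_at_infinity[of sequentially U] by (auto simp: convergent_def)

text \<open>\<open>c_le\<close> and \<open>best\<close> together make \<open>c\<close> the infimum
  of Re F / Re. The bound \<open>step\<close> is the half-plane form of bounded hyperbolic
  steps.\<close>

locale half_plane_backward_orbit =
  fixes F :: "complex \<Rightarrow> complex" and U :: "nat \<Rightarrow> complex" and K c :: real
  assumes hol: "F holomorphic_on right_half_plane"
    and F: "\<And>u. Re u > 0 \<Longrightarrow> Re (F u) > 0"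
    and U: "\<And>n. Re (U n) > 0" "\<And>n. F (U (Suc n)) = U n"
    and inf: "filterlim U at_infinity sequentially"
    and step: "\<And>n. (norm (U n - U (Suc n)))\<^sup>2 \<le> K * (Re (U n) * Re (U (Suc n)))"
    and c_le: "\<And>u. Re u > 0 \<Longrightarrow> c * Re u \<le> Re (F u)"
    and best: "\<And>\<epsilon>. \<epsilon> > 0 \<Longrightarrow> \<exists>v. Re v > 0 \<and> Re (F v) < (c + \<epsilon>) * Re v"
    and c_pos: "c > 0"
    and K_pos: "K > 0"
begin

lemma norm_step: "norm (U n - U (Suc n)) \<le> (K + 1) * Re (U n)" "norm (U n - U (Suc n)) \<le> (K + 1) * Re (U (Suc n))"
  and Re_step: "Re (U n) \<le> (K + 2) * Re (U (Suc n))"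
  using norm_diff_le_Re_if_bounded_step[of K "U n" "U (Suc n)"] norm_diff_le_Re_if_bounded_step[of K "U (Suc n)" "U n"]
    step[of n] U(1) K_pos by (simp_all add: norm_minus_commute mult_ac)

lemma norm_at_top: "filterlim (\<lambda>n. norm (U n)) at_top sequentially"
  using inf by (rule filterlim_at_infinity_imp_norm_at_top)

lemma norm_ge_eventually: "\<forall>\<^sub>F n in sequentially. norm (U n) \<ge> R"
  using norm_at_top by (auto simp: filterlim_at_top)

lemma norm_Suc_ge_eventually: "\<forall>\<^sub>F n in sequentially. norm (U (Suc n)) \<ge> R"
  using norm_ge_eventually[of R] eventually_sequentially_Suc[of "\<lambda>n. norm (U n) \<ge> R"] by blast

text \<open>The orbit would converge, although it tends to infinity.\<close>

lemma no_geometric_decay: "q < 1 \<Longrightarrow> (\<And>n. n \<ge> N \<Longrightarrow> Re (U (Suc n)) \<le> q * Re (U n)) \<Longrightarrow> False"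
  using Re_geometric_decay_imp_convergent[of U "K + 1" q N] norm_step U convergent_not_at_infinity[of U] inf by blast

text \<open>Because \<open>F\<close> moves the orbit one index down, c > 1 would shrink the real
  parts by the factor 1 / c at each backward step.\<close>

lemma c_le_1: "c \<le> 1"
proof (rule ccontr)
  assume "\<not> c \<le> 1"
  hence c1: "c > 1" by simp
  show False
  proof (rule no_geometric_decay[of "1 / c" 0])
    show "Re (U (Suc n)) \<le> 1 / c * Re (U n)" for n
      using c_le[of "U (Suc n)"] U c1 by (simp add: field_simps)
  qed (use c1 in auto)
qed

text \<open>This is the cosine of the argument of \<open>U n\<close>: bounded below means staying in
  a sector, tending to 0 means a tangential orbit.\<close>

definition slope :: "nat \<Rightarrow> real" where "slope n = Re (U n) / norm (U n)"

lemma U_nz: "U n \<noteq> 0" "norm (U n) > 0"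
  using U(1)[of n] by auto

lemma slope_pos: "slope n > 0" and slope_le_1: "slope n \<le> 1"
  using U(1)[of n] U_nz(2)[of n] complex_Re_le_cmod[of "U n"] by (auto simp: slope_def)

lemma Re_eq_slope: "Re (U n) = slope n * norm (U n)"
  using U_nz(2)[of n] by (simp add: slope_def)

lemma JWC_sector:
  assumes "\<epsilon> > 0" "M > 0"
  obtains R where "R > 0"
    "\<And>u::complex. Re u > 0 \<Longrightarrow> norm u \<le> M * Re u \<Longrightarrow> norm u \<ge> R \<Longrightarrow> norm (F u - c * u) \<le> \<epsilon> * norm u"
  using Julia_Wolff_Caratheodory_half_plane[OF hol F c_le best assms] by metis

text \<open>Where \<open>F u\<close> is close to \<open>c u\<close>, a step of bounded hyperbolic length cannot be taken too
  close to the boundary.\<close>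
lemma eventually_slope_Suc_ge:
  assumes c1: "c < 1" and kappa: "\<kappa> > 0"
  shows "\<forall>\<^sub>F n in sequentially. slope n \<ge> \<kappa> \<longrightarrow> slope (Suc n) \<ge> (1 - c) / (2 * (K + 1))"
proof -
  \<comment> \<open>If \<open>U n\<close> lies in the sector given by \<open>\<kappa>\<close>, one
    bounded step leads at most into the wider sector of aperture \<open>M\<close>.\<close>
  define M where "M = (1 / \<kappa> + (K + 1)) * (K + 2)"
  have M: "M > 0" using kappa K_pos by (auto simp: M_def intro!: mult_pos_pos add_pos_pos)
  define \<epsilon> where "\<epsilon> = (1 - c) / 4"
  have e: "\<epsilon> > 0" using c1 by (simp add: \<epsilon>_def)
  \<comment> \<open>Independent of \<open>\<kappa>\<close>: any lower bound for one slope yields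
    this fixed one for the next, which \<open>eventually_slope_ge\<close> exploits. The size is
    chosen for the comparison of 3/8 with 9/16 at the end.\<close>
  define k0 where "k0 = (1 - c) / (2 * (K + 1))"
  have k0: "k0 > 0" "K * k0 \<le> (1 - c) / 2" "k0 \<le> (1 - c) / 2"
    using c1 K_pos by (auto simp: k0_def field_simps)
  obtain R where R: "\<And>u::complex. Re u > 0 \<Longrightarrow> norm u \<le> M * Re u \<Longrightarrow> norm u \<ge> R \<Longrightarrow> norm (F u - c * u) \<le> \<epsilon> * norm u"
    using JWC_sector[OF e M] by metis
  show ?thesis
    using norm_Suc_ge_eventually[of R] unfolding k0_def[symmetric]
  proof eventually_elim
    case (elim n)
    show ?case
    proof (rule impI)
      assume sl: "\<kappa> \<le> slope n"
      define r where "r = norm (U (Suc n))"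
      define k where "k = slope (Suc n)"
      have r: "r > 0" using U_nz by (simp add: r_def)
      have k: "k > 0" using slope_pos by (simp add: k_def)
      have xr: "Re (U (Suc n)) = k * r" using Re_eq_slope by (simp add: k_def r_def)
      have "norm (U n) \<le> 1 / \<kappa> * Re (U n)"
        using sl kappa U_nz(2)[of n] by (simp add: slope_def field_simps)
      moreover have "r \<le> norm (U n) + norm (U n - U (Suc n))"
        using norm_triangle_ineq4[of "U n" "U n - U (Suc n)"] by (simp add: r_def)
      ultimately have "r \<le> 1 / \<kappa> * Re (U n) + (K + 1) * Re (U n)" using norm_step(1)[of n] by linarith
      also have "\<dots> = (1 / \<kappa> + (K + 1)) * Re (U n)" by (simp add: algebra_simps)
      also have "\<dots> \<le> (1 / \<kappa> + (K + 1)) * ((K + 2) * Re (U (Suc n)))"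
        using Re_step[of n] kappa K_pos by (intro mult_left_mono) auto
      finally have "norm (U (Suc n)) \<le> M * Re (U (Suc n))" by (simp add: M_def r_def mult.assoc)
      from R[OF U(1) this elim] have Fr: "norm (U n - c * U (Suc n)) \<le> \<epsilon> * r"
        by (simp add: U(2) r_def)
      \<comment> \<open>Since \<open>U n\<close> is close to \<open>c * U (Suc n)\<close>, the step
        has length at least (1 - c - \<epsilon>) r. The hyperbolic bound on it is small when
        \<open>k\<close> is small.\<close>
      have "norm (of_real (1 - c) * U (Suc n)) \<le> norm (U n - c * U (Suc n)) + norm (U n - U (Suc n))"
        using norm_triangle_ineq4[of "U n - c * U (Suc n)" "U n - U (Suc n)"] by (simp add: algebra_simps)
      moreover have "norm (of_real (1 - c) * U (Suc n)) = (1 - c) * r"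
        using c1 unfolding norm_mult norm_of_real r_def by simp
      ultimately have "norm (U n - U (Suc n)) \<ge> (1 - c - \<epsilon>) * r" using Fr by (simp add: algebra_simps)
      hence lo: "((1 - c - \<epsilon>) * r)\<^sup>2 \<le> (norm (U n - U (Suc n)))\<^sup>2"
        using r c1 by (intro power_mono) (auto simp: \<epsilon>_def)
      have "Re (U n - c * U (Suc n)) \<le> \<epsilon> * r" using Fr complex_Re_le_cmod order_trans by blast
      hence "Re (U n) \<le> (c * k + \<epsilon>) * r" by (simp add: xr algebra_simps)
      hence "K * (Re (U n) * Re (U (Suc n))) \<le> K * (((c * k + \<epsilon>) * r) * (k * r))"
        unfolding xr using K_pos k r by (intro mult_left_mono mult_right_mono) auto
      hence "((1 - c - \<epsilon>) * r)\<^sup>2 \<le> K * (((c * k + \<epsilon>) * r) * (k * r))" using lo step[of n] by linarith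
      hence "((1 - c - \<epsilon>)\<^sup>2) * r\<^sup>2 \<le> (K * k * (c * k + \<epsilon>)) * r\<^sup>2" by (simp add: power2_eq_square mult_ac)
      hence main: "(1 - c - \<epsilon>)\<^sup>2 \<le> K * k * (c * k + \<epsilon>)" using r by simp
      show "k0 \<le> slope (Suc n)"
      proof (rule ccontr)
        assume "\<not> k0 \<le> slope (Suc n)"
        hence kk: "k < k0" by (simp add: k_def)
        have "c * k \<le> 1 * k0" using kk c1 c_pos k by (intro mult_mono) auto
        hence "c * k + \<epsilon> \<le> 3 / 4 * (1 - c)" using k0 by (simp add: \<epsilon>_def field_simps)
        moreover have "K * k \<le> (1 - c) / 2" using kk K_pos k0(2) by (smt (verit) mult_left_mono)
        ultimately have "K * k * (c * k + \<epsilon>) \<le> ((1 - c) / 2) * (3 / 4 * (1 - c))"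
          using K_pos k c_pos c1 e by (intro mult_mono) auto
        hence "K * k * (c * k + \<epsilon>) \<le> 3 / 8 * ((1 - c) * (1 - c))" by (simp add: field_simps)
        moreover have "(1 - c - \<epsilon>)\<^sup>2 = 9 / 16 * ((1 - c) * (1 - c))" by (simp add: \<epsilon>_def power2_eq_square field_simps)
        moreover have "(1 - c) * (1 - c) > 0" using c1 by simp
        ultimately show False using main by linarith
      qed
    qed
  qed
qed

text \<open>Comparing \<open>U (Suc n)\<close> with the real point of the same modulus by the Schwarz--Pick lemma
  shows that a tangential orbit would have geometrically decreasing real parts.\<close>
lemma not_tangential:
  assumes c1: "c < 1" and tang: "slope \<longlonglongrightarrow> 0"
  shows False
proof -
  \<comment> \<open>Small enough for 12 \<epsilon> < (1 - c)^2, which gives 2 c + 2 \<epsilon> < 1 +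
    c^2 - 10 \<epsilon> and so a decay factor below 1.\<close>
  define \<epsilon> where "\<epsilon> = (1 - c)\<^sup>2 / 24"
  have e: "\<epsilon> > 0" using c1 by (simp add: \<epsilon>_def)
  \<comment> \<open>Aperture 1 reduces the sector to the positive real axis, where the comparison
    points lie.\<close>
  obtain R where R0: "R > 0" and R: "\<And>u::complex. Re u > 0 \<Longrightarrow> norm u \<le> 1 * Re u \<Longrightarrow> norm u \<ge> R \<Longrightarrow> norm (F u - c * u) \<le> \<epsilon> * norm u"
    using JWC_sector[OF e zero_less_one] by metis
  \<comment> \<open>Once the slope is below this value, the step is at most \<epsilon> r by
    \<open>norm_step\<close>.\<close>
  define \<mu> where "\<mu> = \<epsilon> / (K + 1)"
  have mu: "\<mu> > 0" "\<mu> \<le> \<epsilon>" "(K + 1) * \<mu> = \<epsilon>" using e K_pos by (auto simp: \<mu>_def field_simps)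
  have "\<forall>\<^sub>F n in sequentially. slope (Suc n) < \<mu>"
    using order_tendstoD(2)[OF LIMSEQ_Suc[OF tang] mu(1)] .
  hence "\<forall>\<^sub>F n in sequentially. (1 + c\<^sup>2 - 10 * \<epsilon>) * Re (U (Suc n)) \<le> (2 * c + 2 * \<epsilon>) * Re (U n)"
    using norm_Suc_ge_eventually[of R]
  proof eventually_elim
    case (elim n)
    define r where "r = norm (U (Suc n))"
    define k where "k = slope (Suc n)"
    define v where "v = complex_of_real r"
    have r: "r > 0" using U_nz by (simp add: r_def)
    have k: "k > 0" "k < \<mu>" using slope_pos elim by (auto simp: k_def)
    have xr: "Re (U (Suc n)) = k * r" using Re_eq_slope by (simp add: k_def r_def)
    have rr: "(Re (U (Suc n)))\<^sup>2 + (Im (U (Suc n)))\<^sup>2 = r\<^sup>2" by (simp add: r_def cmod_power2)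
    have v: "Re v = r" "norm v = r" "Re v > 0" using r by (auto simp: v_def)
    have Fv: "norm (F v - c * v) \<le> \<epsilon> * r" using R[of v] v elim r by (simp add: r_def)
    \<comment> \<open>The main part of \<open>F v - U n\<close>: \<open>F v\<close> is close to
      \<open>c * v\<close>, and \<open>U n\<close> to \<open>U (Suc n)\<close>. As
      \<open>U (Suc n)\<close> is nearly vertical, |A|^2 is close to (1 + c^2) r^2.\<close>
    define A where "A = c * v - U (Suc n)"
    have A2: "(norm A)\<^sup>2 = r\<^sup>2 * (1 + c\<^sup>2 - 2 * c * k)"
    proof -
      have "(norm A)\<^sup>2 = (c * r - Re (U (Suc n)))\<^sup>2 + (Im (U (Suc n)))\<^sup>2"
        by (simp add: A_def cmod_power2 v_def)
      also have "\<dots> = c\<^sup>2 * r\<^sup>2 - 2 * c * r * Re (U (Suc n)) + r\<^sup>2"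
        using rr by (simp add: power2_diff power_mult_distrib)
      finally show ?thesis unfolding xr by (simp add: power2_eq_square algebra_simps)
    qed
    have "norm A \<le> c * r + r"
      using norm_triangle_ineq4[of "c * v" "U (Suc n)"] c_pos v by (simp add: A_def norm_mult r_def)
    hence nA: "norm A \<le> 2 * r" using c1 r by (smt (verit) mult_le_cancel_right2)
    define E where "E = F v - U n - A"
    have "E = (F v - c * v) - (U n - U (Suc n))" by (simp add: E_def A_def)
    hence "norm E \<le> \<epsilon> * r + (K + 1) * Re (U (Suc n))"
      using norm_triangle_ineq4[of "F v - c * v" "U n - U (Suc n)"] Fv norm_step(2)[of n] by simp
    also have "(K + 1) * Re (U (Suc n)) \<le> (K + 1) * (\<mu> * r)"
      unfolding xr using k r K_pos by (intro mult_left_mono mult_right_mono) auto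
    also have "\<dots> = \<epsilon> * r" using mu(3) by simp
    finally have nE: "norm E \<le> 2 * \<epsilon> * r" by simp
    have "norm A \<le> norm (F v - U n) + norm E"
      using norm_triangle_ineq4[of "F v - U n" E] by (simp add: E_def)
    \<comment> \<open>The inequality between arithmetic and geometric mean makes the loss 8
      \<epsilon> r^2; the term 2 c k in |A|^2 costs another 2 \<epsilon> r^2.\<close>
    hence "(norm A)\<^sup>2 \<le> norm A * (norm (F v - U n) + norm E)" by (simp add: power2_eq_square mult_left_mono)
    moreover have "norm A * norm E \<le> (2 * r) * (2 * \<epsilon> * r)" using nA nE r by (intro mult_mono) auto
    moreover have "norm A * norm (F v - U n) \<le> ((norm A)\<^sup>2 + (norm (F v - U n))\<^sup>2) / 2"
      using sum_squares_bound[of "norm A" "norm (F v - U n)"] by simp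
    ultimately have "(norm (F v - U n))\<^sup>2 \<ge> (norm A)\<^sup>2 - 8 * \<epsilon> * r\<^sup>2"
      by (simp add: power2_eq_square algebra_simps)
    moreover have "c * k \<le> \<epsilon>" using k mu c1 c_pos mult_mono[of c 1 k \<epsilon>] by simp
    hence "r\<^sup>2 * (2 * c * k) \<le> r\<^sup>2 * (2 * \<epsilon>)" by (intro mult_left_mono) auto
    ultimately have low: "(norm (F v - U n))\<^sup>2 \<ge> (1 + c\<^sup>2 - 10 * \<epsilon>) * r\<^sup>2"
      unfolding A2 by (simp add: algebra_simps)
    have "(norm (v - U (Suc n)))\<^sup>2 = 2 * r\<^sup>2 - 2 * r * Re (U (Suc n))"
      unfolding cmod_power2 using rr by (simp add: v_def power2_eq_square algebra_simps)
    hence up: "(norm (v - U (Suc n)))\<^sup>2 \<le> 2 * r\<^sup>2" using r U(1)[of "Suc n"] by simp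
    have ReFv: "Re (F v) \<le> (c + \<epsilon>) * r"
      using order_trans[OF complex_Re_le_cmod Fv] v by (simp add: algebra_simps)
    \<comment> \<open>Schwarz-Pick for \<open>v\<close> and \<open>U (Suc n)\<close>. After
      cancelling r^3 the quotient of successive real parts is at most about 2 c / (1 + c^2), which
      is below 1 for c < 1.\<close>
    have "((1 + c\<^sup>2 - 10 * \<epsilon>) * r\<^sup>2) * (r * Re (U (Suc n))) \<le> (norm (F v - U n))\<^sup>2 * (r * Re (U (Suc n)))"
      using low r U(1)[of "Suc n"] by (intro mult_right_mono) auto
    also have "\<dots> \<le> (norm (v - U (Suc n)))\<^sup>2 * (Re (F v) * Re (U n))"
      using Schwarz_Pick_half_plane[OF hol F v(3) U(1)[of "Suc n"]] by (simp add: U(2) v(1))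
    also have "\<dots> \<le> (2 * r\<^sup>2) * (((c + \<epsilon>) * r) * Re (U n))"
      using up ReFv F[OF v(3)] U(1)[of n] by (intro mult_mono mult_right_mono) auto
    finally have "((1 + c\<^sup>2 - 10 * \<epsilon>) * Re (U (Suc n))) * (r\<^sup>2 * r) \<le> ((2 * c + 2 * \<epsilon>) * Re (U n)) * (r\<^sup>2 * r)"
      by (simp add: algebra_simps)
    thus ?case using r by simp
  qed
  then obtain N where N: "\<And>n. n \<ge> N \<Longrightarrow> (1 + c\<^sup>2 - 10 * \<epsilon>) * Re (U (Suc n)) \<le> (2 * c + 2 * \<epsilon>) * Re (U n)"
    by (auto simp: eventually_sequentially)
  have "12 * \<epsilon> < (1 - c)\<^sup>2" using c1 by (simp add: \<epsilon>_def)
  hence lt: "2 * c + 2 * \<epsilon> < 1 + c\<^sup>2 - 10 * \<epsilon>" by (simp add: power2_eq_square algebra_simps)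
  have den: "1 + c\<^sup>2 - 10 * \<epsilon> > 0" using lt e c_pos by linarith
  show False
  proof (rule no_geometric_decay)
    show "(2 * c + 2 * \<epsilon>) / (1 + c\<^sup>2 - 10 * \<epsilon>) < 1" using lt den by simp
    show "Re (U (Suc n)) \<le> (2 * c + 2 * \<epsilon>) / (1 + c\<^sup>2 - 10 * \<epsilon>) * Re (U n)" if "n \<ge> N" for n
      using N[OF that] den by (simp add: pos_le_divide_eq mult_ac)
  qed
qed

text \<open>Far out, a slope of at least \<open>k0\<close> is inherited by all later terms. If no
  such slope occurred, the orbit would be tangential, against \<open>not_tangential\<close>.\<close>

lemma eventually_slope_ge:
  assumes c1: "c < 1"
  obtains \<kappa> where "\<kappa> > 0" "\<forall>\<^sub>F n in sequentially. slope n \<ge> \<kappa>"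
proof -
  define k0 where "k0 = (1 - c) / (2 * (K + 1))"
  have k0: "k0 > 0" using c1 K_pos by (simp add: k0_def)
  have ev: "\<forall>\<^sub>F n in sequentially. slope n \<ge> \<kappa> \<longrightarrow> slope (Suc n) \<ge> k0" if "\<kappa> > 0" for \<kappa>
    using eventually_slope_Suc_ge[OF c1 that] by (simp add: k0_def)
  obtain N where N: "\<And>n. n \<ge> N \<Longrightarrow> slope n \<ge> k0 \<Longrightarrow> slope (Suc n) \<ge> k0"
    using ev[OF k0] by (auto simp: eventually_sequentially)
  have "\<exists>n\<ge>N. slope n \<ge> k0"
  proof (rule ccontr)
    assume neg: "\<not> ?thesis"
    \<comment> \<open>A late slope of at least e would force the next one up to \<open>k0\<close>,
      which is excluded here.\<close>
    have "slope \<longlonglongrightarrow> 0"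
    proof (rule tendstoI)
      fix e :: real assume "e > 0"
      from ev[OF this] eventually_ge_at_top[of N] show "\<forall>\<^sub>F n in sequentially. dist (slope n) 0 < e"
      proof eventually_elim
        case (elim n)
        thus ?case using neg slope_pos[of n] by (auto simp: not_le dest: spec[of _ "Suc n"])
      qed
    qed
    thus False using not_tangential[OF c1] by blast
  qed
  then obtain n where n: "n \<ge> N" "slope n \<ge> k0" by blast
  have "slope m \<ge> k0" if "m \<ge> n" for m
    using that by (induction m rule: dec_induct) (use n N in auto)
  thus ?thesis using that[OF k0] by (auto simp: eventually_sequentially)
qed

text \<open>In a sector U n / U (Suc n) tends to c > 0, so directions change less and less. The
  limit of the hyperbolic steps fixes the limit of the slopes, leaving two conjugate directions, and
  connectedness of the cluster set selects one.\<close>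

lemma direction_convergent:
  assumes c1: "c < 1"
    and lim: "(\<lambda>n. (norm (U n - U (Suc n)))\<^sup>2 / (Re (U n) * Re (U (Suc n)))) \<longlonglongrightarrow> K"
  obtains e where "Re e > 0" "(\<lambda>n. U n / norm (U n)) \<longlonglongrightarrow> e"
proof -
  obtain \<kappa> where kappa: "\<kappa> > 0" and ev: "\<forall>\<^sub>F n in sequentially. slope n \<ge> \<kappa>"
    using eventually_slope_ge[OF c1] by blast
  define q where "q = (\<lambda>n. U n / U (Suc n))"
  have q: "q \<longlonglongrightarrow> of_real c"
  proof (rule tendstoI)
    fix e :: real assume e: "e > 0"
    obtain R where R: "\<And>u::complex. Re u > 0 \<Longrightarrow> norm u \<le> (1 / \<kappa>) * Re u \<Longrightarrow> norm u \<ge> R \<Longrightarrow> norm (F u - c * u) \<le> (e / 2) * norm u"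
      using JWC_sector[of "e / 2" "1 / \<kappa>"] e kappa by (metis half_gt_zero zero_less_divide_1_iff)
    have "\<forall>\<^sub>F n in sequentially. slope (Suc n) \<ge> \<kappa>" using ev eventually_sequentially_Suc[of "\<lambda>n. slope n \<ge> \<kappa>"] by blast
    with norm_Suc_ge_eventually[of R] show "\<forall>\<^sub>F n in sequentially. dist (q n) (of_real c) < e"
    proof eventually_elim
      case (elim n)
      have "norm (U (Suc n)) \<le> (1 / \<kappa>) * Re (U (Suc n))"
        using elim(2) kappa U_nz(2)[of "Suc n"] by (simp add: slope_def field_simps)
      from R[OF U(1) this elim(1)] have "norm (U n - c * U (Suc n)) \<le> e / 2 * norm (U (Suc n))" by (simp add: U(2))
      moreover have "q n - of_real c = (U n - c * U (Suc n)) / U (Suc n)"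
        using U_nz[of "Suc n"] by (simp add: q_def field_simps)
      ultimately have "norm (q n - of_real c) \<le> e / 2"
        using U_nz[of "Suc n"] by (simp add: norm_divide pos_divide_le_eq)
      thus ?case using e by (simp add: dist_norm)
    qed
  qed
  define d where "d = (\<lambda>n. U n / norm (U n))"
  have nd: "norm (d n) = 1" for n using U_nz[of n] by (simp add: d_def norm_divide)
  have Re_d: "Re (d n) = slope n" for n by (simp add: d_def slope_def)
  have dstep: "d n = d (Suc n) * (q n / norm (q n))" for n
    using U_nz[of n] U_nz[of "Suc n"] by (simp add: d_def q_def norm_divide field_simps)
  have sq: "(\<lambda>n. q n / norm (q n)) \<longlonglongrightarrow> 1"
  proof -
    have "(\<lambda>n. q n / norm (q n)) \<longlonglongrightarrow> of_real c / of_real (norm (complex_of_real c))"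
      using c_pos by (intro tendsto_intros q) auto
    thus ?thesis using c_pos by simp
  qed
  have dd: "(\<lambda>n. dist (d n) (d (Suc n))) \<longlonglongrightarrow> 0"
  proof -
    have "dist (d n) (d (Suc n)) = norm (q n / norm (q n) - 1)" for n
    proof -
      have "d n - d (Suc n) = d (Suc n) * (q n / norm (q n) - 1)" by (subst dstep) (simp add: algebra_simps)
      thus ?thesis by (simp add: dist_norm norm_mult nd)
    qed
    moreover have "(\<lambda>n. norm (q n / norm (q n) - 1)) \<longlonglongrightarrow> norm (1 - 1 :: complex)"
      by (intro tendsto_intros sq)
    ultimately show ?thesis by simp
  qed
  define \<delta> where "\<delta> = (\<lambda>n. (norm (U n - U (Suc n)))\<^sup>2 / (Re (U n) * Re (U (Suc n))))"
  \<comment> \<open>|q - 1|^2 / |q| is the squared step over |U n| |U (Suc n)|; dividing by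
    \<open>\<delta>\<close> leaves the product of the two slopes.\<close>
  have prod: "(\<lambda>n. slope n * slope (Suc n)) \<longlonglongrightarrow> (1 - c)\<^sup>2 / K / c"
  proof -
    have d0: "\<forall>\<^sub>F n in sequentially. \<delta> n > 0" using lim K_pos unfolding \<delta>_def by (rule order_tendstoD(1))
    have "(\<lambda>n. (norm (q n - 1))\<^sup>2 / \<delta> n / norm (q n)) \<longlonglongrightarrow> (norm (of_real c - 1 :: complex))\<^sup>2 / K / norm (of_real c :: complex)"
      using c_pos K_pos by (intro tendsto_intros q lim[folded \<delta>_def]) auto
    moreover have "norm (of_real c - 1 :: complex) = 1 - c"
      using c1 norm_of_real[of "c - 1", where ?'a = complex] by simp
    ultimately have "(\<lambda>n. (norm (q n - 1))\<^sup>2 / \<delta> n / norm (q n)) \<longlonglongrightarrow> (1 - c)\<^sup>2 / K / c" using c_pos by simp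
    moreover have "\<forall>\<^sub>F n in sequentially. (norm (q n - 1))\<^sup>2 / \<delta> n / norm (q n) = slope n * slope (Suc n)"
      using d0
    proof eventually_elim
      case (elim n)
      have "q n - 1 = (U n - U (Suc n)) / U (Suc n)" using U_nz[of "Suc n"] by (simp add: q_def field_simps)
      moreover have "U n \<noteq> U (Suc n)" using elim by (auto simp: \<delta>_def)
      ultimately show ?case using elim U(1)[of n] U(1)[of "Suc n"] U_nz(2)[of n] U_nz(2)[of "Suc n"]
        by (simp add: \<delta>_def q_def slope_def norm_divide power_divide power2_eq_square)
    qed
    ultimately show ?thesis by (rule Lim_transform_eventually)
  qed
  have sdiff: "(\<lambda>n. slope n - slope (Suc n)) \<longlonglongrightarrow> 0"
  proof (rule Lim_null_comparison[OF _ dd], rule always_eventually, rule allI)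
    fix n show "norm (slope n - slope (Suc n)) \<le> dist (d n) (d (Suc n))"
      using abs_Re_le_cmod[of "d n - d (Suc n)"] by (simp add: Re_d dist_norm)
  qed
  define \<sigma> where "\<sigma> = sqrt ((1 - c)\<^sup>2 / K / c)"
  have slim: "slope \<longlonglongrightarrow> \<sigma>"
  proof -
    \<comment> \<open>Added to the product of consecutive slopes, this null sequence gives the
      square of the slope.\<close>
    have "(\<lambda>n. slope n * (slope n - slope (Suc n))) \<longlonglongrightarrow> 0"
    proof (rule Lim_null_comparison[OF _ tendsto_rabs_zero[OF sdiff]], rule always_eventually, rule allI)
      fix n show "norm (slope n * (slope n - slope (Suc n))) \<le> \<bar>slope n - slope (Suc n)\<bar>"
        using slope_pos[of n] slope_le_1[of n] by (simp add: abs_mult mult_left_le_one_le)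
    qed
    from tendsto_add[OF prod this] have "(\<lambda>n. (slope n)\<^sup>2) \<longlonglongrightarrow> (1 - c)\<^sup>2 / K / c"
      by (simp add: power2_eq_square algebra_simps)
    hence "(\<lambda>n. sqrt ((slope n)\<^sup>2)) \<longlonglongrightarrow> \<sigma>" unfolding \<sigma>_def by (rule tendsto_real_sqrt)
    thus ?thesis using slope_pos by (simp add: less_imp_le)
  qed
  have bdd: "bounded (range d)" using nd by (intro boundedI[of _ 1]) auto
  have sub: "cluster_points d \<subseteq> {Complex \<sigma> (sqrt (1 - \<sigma>\<^sup>2)), Complex \<sigma> (- sqrt (1 - \<sigma>\<^sup>2))}"
  proof
    fix z assume "z \<in> cluster_points d"
    then obtain r where r: "strict_mono (r :: nat \<Rightarrow> nat)" "(d \<circ> r) \<longlonglongrightarrow> z" by (rule cluster_points_subseq)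
    have "(\<lambda>n. norm ((d \<circ> r) n)) \<longlonglongrightarrow> norm z" by (intro tendsto_intros r)
    hence nz: "norm z = 1" using nd by (simp add: LIMSEQ_const_iff)
    have "(\<lambda>n. Re ((d \<circ> r) n)) \<longlonglongrightarrow> Re z" by (intro tendsto_intros r)
    moreover have "(\<lambda>n. Re ((d \<circ> r) n)) \<longlonglongrightarrow> \<sigma>"
      using LIMSEQ_subseq_LIMSEQ[OF slim r(1)] by (simp add: Re_d comp_def)
    ultimately have rez: "Re z = \<sigma>" by (rule LIMSEQ_unique)
    have "(Im z)\<^sup>2 = 1 - \<sigma>\<^sup>2" using nz rez cmod_power2[of z] by simp
    hence "\<bar>Im z\<bar> = sqrt (1 - \<sigma>\<^sup>2)" by (metis real_sqrt_abs)
    thus "z \<in> {Complex \<sigma> (sqrt (1 - \<sigma>\<^sup>2)), Complex \<sigma> (- sqrt (1 - \<sigma>\<^sup>2))}"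
      using rez by (cases "Im z \<ge> 0") (auto simp: complex_eq_iff)
  qed
  \<comment> \<open>A finite connected set has at most one point.\<close>
  have "finite (cluster_points d)" by (rule finite_subset[OF sub]) auto
  hence "\<exists>e. cluster_points d \<subseteq> {e}"
    using connected_finite_iff_sing[OF connected_cluster_points[OF bdd dd]] by auto
  then obtain e where "d \<longlonglongrightarrow> e" using convergent_if_cluster_points_singleton[OF bdd] by blast
  moreover have "Re e \<ge> \<kappa>"
  proof (rule tendsto_lowerbound)
    show "(\<lambda>n. Re (d n)) \<longlonglongrightarrow> Re e" by (intro tendsto_intros \<open>d \<longlonglongrightarrow> e\<close>)
    show "\<forall>\<^sub>F n in sequentially. \<kappa> \<le> Re (d n)" using ev by (simp add: Re_d)
  qed auto
  ultimately show ?thesis using kappa by (intro that[of e]) (auto simp: d_def)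
qed

end

subsection \<open>Angular derivatives in the disk\<close>

definition half_plane_conj :: "(complex \<Rightarrow> complex) \<Rightarrow> complex \<Rightarrow> complex \<Rightarrow> complex" where
  "half_plane_conj \<phi> \<zeta> = cayley \<zeta> \<circ> \<phi> \<circ> cayley_inv \<zeta>"

lemma analytic_self_mapD:
  assumes "analytic_self_map \<phi>"
  shows "\<phi> holomorphic_on ball 0 1" "norm z < 1 \<Longrightarrow> norm (\<phi> z) < 1"
  using assms by (auto simp: analytic_self_map_def image_subset_iff)

lemma half_plane_conj_cayley:
  "norm \<zeta> = 1 \<Longrightarrow> norm z < 1 \<Longrightarrow> half_plane_conj \<phi> \<zeta> (cayley \<zeta> z) = cayley \<zeta> (\<phi> z)"
  unfolding half_plane_conj_def using cayley_inv_cayley[of \<zeta> z] by force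

lemma cayley_inv_surj:
  assumes "norm \<zeta> = 1" "Re u > 0"
  obtains z where "norm z < 1" "u = cayley \<zeta> z"
proof (rule that)
  show "norm (cayley_inv \<zeta> u) < 1" by (rule norm_cayley_inv_less_1[OF assms])
  show "u = cayley \<zeta> (cayley_inv \<zeta> u)" using assms by (subst cayley_cayley_inv) auto
qed

lemma Re_half_plane_conj_pos:
  assumes "analytic_self_map \<phi>" "norm \<zeta> = 1" "Re u > 0"
  shows "Re (half_plane_conj \<phi> \<zeta> u) > 0"
proof -
  obtain z where "norm z < 1" "u = cayley \<zeta> z" using cayley_inv_surj[OF assms(2,3)] by blast
  thus ?thesis using assms by (simp add: half_plane_conj_cayley Re_cayley_pos analytic_self_mapD(2))
qed

lemma half_plane_conj_holomorphic:
  assumes "analytic_self_map \<phi>" "norm \<zeta> = 1"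
  shows "half_plane_conj \<phi> \<zeta> holomorphic_on right_half_plane"
proof -
  have "cayley_inv \<zeta> ` right_half_plane \<subseteq> ball 0 1" "\<phi> ` ball 0 1 \<subseteq> ball 0 1"
    using norm_cayley_inv_less_1[OF assms(2)] analytic_self_mapD(2)[OF assms(1)] by auto
  thus ?thesis unfolding half_plane_conj_def
    by (intro holomorphic_on_compose_gen[OF cayley_inv_holomorphic
          holomorphic_on_compose_gen[OF analytic_self_mapD(1)[OF assms(1)] cayley_holomorphic[OF assms(2)]]])
qed

lemma cayley_inv_eq: "u \<noteq> -1 \<Longrightarrow> cayley_inv \<zeta> u = \<zeta> - 2 * \<zeta> / (u + 1)"
proof -
  assume "u \<noteq> -1"
  hence "u + 1 \<noteq> 0" by (simp add: add_eq_0_iff2)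
  thus ?thesis by (simp add: cayley_inv_def divide_simps) (simp add: algebra_simps)
qed

text \<open>The quantity cayley + 1 has modulus exactly 2 / |\<zeta> - z|, so the Stolz condition
  becomes a sector condition. Using \<open>max M 1\<close> keeps the aperture positive for every
  \<open>M\<close>.\<close>

lemma eventually_stolz_region:
  assumes zeta: "norm \<zeta> = 1"
  shows "\<forall>\<^sub>F z in at \<zeta> within stolz_region \<zeta> M. norm z < 1 \<and>
    norm (cayley \<zeta> z) \<le> (2 * max M 1) * Re (cayley \<zeta> z) \<and> norm (cayley \<zeta> z) \<ge> R"
  unfolding eventually_at
proof (intro exI conjI ballI impI)
  define d where "d = 2 / (max R 0 + 1)"
  show "d > 0" by (simp add: d_def)
  fix z assume z: "z \<in> stolz_region \<zeta> M" and "z \<noteq> \<zeta> \<and> dist z \<zeta> < d"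
  hence dist: "norm (\<zeta> - z) < d" by (simp add: dist_norm norm_minus_commute)
  show z1: "norm z < 1" using z by (simp add: stolz_region_def)
  have ne: "\<zeta> \<noteq> z" using z1 zeta by auto
  hence pos: "norm (\<zeta> - z) > 0" by simp
  have n1: "norm (cayley \<zeta> z + 1) = 2 / norm (\<zeta> - z)"
    using cayley_plus_1[OF ne] zeta by (simp add: norm_divide norm_mult)
  have "M * (1 - norm z) \<le> max M 1 * (1 - norm z)" using z1 by (intro mult_right_mono) auto
  moreover have "norm (\<zeta> - z) < M * (1 - norm z)" using z by (simp add: stolz_region_def)
  ultimately have Mp: "norm (\<zeta> - z) \<le> max M 1 * (1 - norm z)" by linarith
  have "1 - norm z \<le> 1 - (norm z)\<^sup>2"
    using z1 by (simp add: power2_eq_square mult_left_le)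
  hence "norm (\<zeta> - z) \<le> max M 1 * (1 - (norm z)\<^sup>2)"
    using Mp by (elim order_trans) (auto intro!: mult_left_mono simp: le_max_iff_disj)
  hence "1 / norm (\<zeta> - z) \<le> max M 1 * Re (cayley \<zeta> z)"
    using pos by (simp add: Re_cayley[OF zeta] field_simps power2_eq_square)
  hence a: "norm (cayley \<zeta> z + 1) \<le> (2 * max M 1) * Re (cayley \<zeta> z)" unfolding n1 by simp
  have "(norm (cayley \<zeta> z))\<^sup>2 \<le> (norm (cayley \<zeta> z + 1))\<^sup>2"
    using Re_cayley_pos[OF zeta z1] unfolding cmod_power2 by (simp add: power2_eq_square algebra_simps)
  hence "norm (cayley \<zeta> z) \<le> norm (cayley \<zeta> z + 1)" by (rule power2_le_imp_le) simp
  thus "norm (cayley \<zeta> z) \<le> (2 * max M 1) * Re (cayley \<zeta> z)" using a by linarith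
  have "max R 0 + 1 < 2 / norm (\<zeta> - z)"
    using dist pos by (simp add: d_def field_simps add_nonneg_pos)
  moreover have "norm (cayley \<zeta> z + 1) \<le> norm (cayley \<zeta> z) + 1" using norm_triangle_ineq[of "cayley \<zeta> z" 1] by simp
  ultimately show "norm (cayley \<zeta> z) \<ge> R" unfolding n1 by linarith
qed

lemma DERIV_cayley: "\<zeta> \<noteq> z \<Longrightarrow> (cayley \<zeta> has_field_derivative 2 * \<zeta> / (\<zeta> - z)\<^sup>2) (at z)"
  unfolding cayley_def
  by (rule derivative_eq_intros refl | simp)+ (simp add: field_simps power2_eq_square)

lemma DERIV_cayley_inv: "u \<noteq> -1 \<Longrightarrow> (cayley_inv \<zeta> has_field_derivative 2 * \<zeta> / (u + 1)\<^sup>2) (at u)"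
  unfolding cayley_inv_def
  by (rule derivative_eq_intros refl | simp add: add_eq_0_iff2)+ (simp add: field_simps power2_eq_square)

text \<open>The chain rule, with the derivatives of the two Cayley maps merged into one square. Its
  limit can be read off from F u / u and the derivative of \<open>F\<close>.\<close>

lemma deriv_self_map_eq:
  assumes phi: "analytic_self_map \<phi>" and zeta: "norm \<zeta> = 1" and z: "norm z < 1"
  shows "deriv \<phi> z = deriv (half_plane_conj \<phi> \<zeta>) (cayley \<zeta> z) *
           ((cayley \<zeta> z + 1) / (half_plane_conj \<phi> \<zeta> (cayley \<zeta> z) + 1))\<^sup>2"
proof -
  define F where "F = half_plane_conj \<phi> \<zeta>"
  define p where "p = cayley \<zeta> z"
  have ne: "\<zeta> \<noteq> z" using zeta z by auto
  have p: "Re p > 0" using Re_cayley_pos[OF zeta z] by (simp add: p_def)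
  have Fp: "Re (F p) > 0" unfolding F_def by (rule Re_half_plane_conj_pos[OF phi zeta p])
  hence Fp1: "F p \<noteq> -1" by auto
  have eq: "(cayley_inv \<zeta> \<circ> (F \<circ> cayley \<zeta>)) x = \<phi> x" if "x \<in> ball 0 1" for x
  proof -
    have "norm x < 1" using that by simp
    moreover from this have "\<zeta> \<noteq> \<phi> x" using zeta analytic_self_mapD(2)[OF phi, of x] by auto
    ultimately show ?thesis using zeta by (auto simp: F_def half_plane_conj_cayley intro!: cayley_inv_cayley)
  qed
  have "(F has_field_derivative deriv F p) (at p)"
    unfolding F_def using p
    by (intro holomorphic_derivI[OF half_plane_conj_holomorphic[OF phi zeta] open_halfspace_Re_gt]) simp
  hence "(F \<circ> cayley \<zeta> has_field_derivative deriv F p * (2 * \<zeta> / (\<zeta> - z)\<^sup>2)) (at z)"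
    unfolding p_def by (intro DERIV_chain DERIV_cayley ne)
  moreover have "(cayley_inv \<zeta> has_field_derivative 2 * \<zeta> / (F p + 1)\<^sup>2) (at ((F \<circ> cayley \<zeta>) z))"
    using DERIV_cayley_inv[OF Fp1] by (simp add: p_def)
  ultimately have "(cayley_inv \<zeta> \<circ> (F \<circ> cayley \<zeta>) has_field_derivative
      2 * \<zeta> / (F p + 1)\<^sup>2 * (deriv F p * (2 * \<zeta> / (\<zeta> - z)\<^sup>2))) (at z)"
    by (rule DERIV_chain[rotated])
  hence "(\<phi> has_field_derivative 2 * \<zeta> / (F p + 1)\<^sup>2 * (deriv F p * (2 * \<zeta> / (\<zeta> - z)\<^sup>2))) (at z)"
    by (rule has_field_derivative_transform_within_open[of _ _ _ "ball 0 1"]) (use z eq in auto)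
  hence "deriv \<phi> z = 2 * \<zeta> / (F p + 1)\<^sup>2 * (deriv F p * (2 * \<zeta> / (\<zeta> - z)\<^sup>2))" by (rule DERIV_imp_deriv)
  also have "\<dots> = deriv F p * ((2 * \<zeta> / (\<zeta> - z)) / (F p + 1))\<^sup>2"
    by (simp add: power2_eq_square mult_ac)
  also have "2 * \<zeta> / (\<zeta> - z) = p + 1" using cayley_plus_1[OF ne] by (simp add: p_def)
  finally show ?thesis by (simp add: F_def p_def)
qed

text \<open>In a Stolz region both F p / p and the derivative of \<open>F\<close> at p tend to c, so
  \<open>deriv_self_map_eq\<close> gives c (1 / c)^2 = 1 / c. Also F p tends to infinity, that is,
  \<open>\<phi>\<close> tends to \<open>\<zeta>\<close>.\<close>

theorem Julia_Wolff_Caratheodory: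
  assumes phi: "analytic_self_map \<phi>" and zeta: "norm \<zeta> = 1" and c: "c > 0"
    and c_le: "\<And>u. Re u > 0 \<Longrightarrow> c * Re u \<le> Re (half_plane_conj \<phi> \<zeta> u)"
    and best: "\<And>\<epsilon>. \<epsilon> > 0 \<Longrightarrow> \<exists>v. Re v > 0 \<and> Re (half_plane_conj \<phi> \<zeta> v) < (c + \<epsilon>) * Re v"
  shows "boundary_fixed_point \<phi> \<zeta>" "has_multiplier \<phi> \<zeta> (1 / c)"
proof -
  define F where "F = half_plane_conj \<phi> \<zeta>"
  define p where "p = cayley \<zeta>"
  have lims: "(\<phi> \<longlongrightarrow> \<zeta>) (at \<zeta> within stolz_region \<zeta> M)"
     "(deriv \<phi> \<longlongrightarrow> of_real (1 / c)) (at \<zeta> within stolz_region \<zeta> M)" for M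
  proof -
    define G where "G = at \<zeta> within stolz_region \<zeta> M"
    have ev: "\<forall>\<^sub>F z in G. norm z < 1 \<and> Re (p z) > 0 \<and> norm (p z) \<le> (2 * max M 1) * Re (p z) \<and> norm (p z) \<ge> R" for R
      using eventually_stolz_region[OF zeta, of M R] unfolding G_def p_def
      by eventually_elim (use Re_cayley_pos[OF zeta] in auto)
    have near: "\<forall>\<^sub>F z in G. norm (F (p z) / p z - c) < e \<and> norm (deriv F (p z) - c) < e" if "e > 0" for e
    proof -
      obtain R where R: "R > 0"
        "\<And>u::complex. Re u > 0 \<Longrightarrow> norm u \<le> (2 * max M 1) * Re u \<Longrightarrow> norm u \<ge> R \<Longrightarrow> norm (F u - c * u) \<le> e / 2 * norm u"
        "\<And>u::complex. Re u > 0 \<Longrightarrow> norm u \<le> (2 * max M 1) * Re u \<Longrightarrow> norm u \<ge> R \<Longrightarrow> norm (deriv F u - c) \<le> e / 2"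
        using Julia_Wolff_Caratheodory_half_plane[OF half_plane_conj_holomorphic[OF phi zeta]
            Re_half_plane_conj_pos[OF phi zeta] c_le best, of "e / 2" "2 * max M 1"] \<open>e > 0\<close>
        unfolding F_def by (metis (no_types, lifting) half_gt_zero less_max_iff_disj mult_pos_pos zero_less_numeral zero_less_one)
      show ?thesis using ev[of R]
      proof eventually_elim
        case (elim z)
        hence p0: "norm (p z) > 0" using R(1) by linarith
        have "F (p z) / p z - c = (F (p z) - c * p z) / p z" using p0 by (simp add: field_simps)
        hence "norm (F (p z) / p z - c) \<le> e / 2" using R(2)[of "p z"] elim p0 by (simp add: norm_divide pos_divide_le_eq)
        thus ?case using R(3)[of "p z"] elim \<open>e > 0\<close> by auto
      qed
    qed
    have q1: "((\<lambda>z. F (p z) / p z) \<longlongrightarrow> of_real c) G"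
      by (rule tendstoI, rule eventually_mono[OF near]) (auto simp: dist_norm)
    have q2: "((\<lambda>z. deriv F (p z)) \<longlongrightarrow> of_real c) G"
      by (rule tendstoI, rule eventually_mono[OF near]) (auto simp: dist_norm)
    have pinf: "filterlim p at_infinity G"
      unfolding filterlim_at_infinity[OF order_refl]
      by (intro allI impI, rule eventually_mono[OF ev]) auto
    have ip: "((\<lambda>z. 1 / p z) \<longlongrightarrow> 0) G" by (rule tendsto_divide_0[OF tendsto_const pinf])
    have q: "((\<lambda>z. (1 + 1 / p z) / (F (p z) / p z + 1 / p z)) \<longlongrightarrow> (1 + 0) / (of_real c + 0)) G"
      using c by (intro tendsto_intros ip q1) auto
    have q3: "((\<lambda>z. (p z + 1) / (F (p z) + 1)) \<longlongrightarrow> 1 / of_real c) G"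
    proof (rule Lim_transform_eventually)
      show "((\<lambda>z. (1 + 1 / p z) / (F (p z) / p z + 1 / p z)) \<longlongrightarrow> 1 / of_real c) G" using q by simp
      show "\<forall>\<^sub>F z in G. (1 + 1 / p z) / (F (p z) / p z + 1 / p z) = (p z + 1) / (F (p z) + 1)"
        using ev[of 1]
      proof eventually_elim
        case (elim z)
        hence "p z \<noteq> 0" by auto
        hence "1 + 1 / p z = (p z + 1) / p z" "F (p z) / p z + 1 / p z = (F (p z) + 1) / p z" by (simp_all add: field_simps)
        thus ?case using \<open>p z \<noteq> 0\<close> by simp
      qed
    qed
    have "((\<lambda>z. deriv F (p z) * ((p z + 1) / (F (p z) + 1))\<^sup>2) \<longlongrightarrow> of_real c * (1 / of_real c)\<^sup>2) G"
      by (intro tendsto_intros q2 q3)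
    moreover have "complex_of_real c * (1 / of_real c)\<^sup>2 = of_real (1 / c)" using c by (simp add: power2_eq_square)
    ultimately have "((\<lambda>z. deriv F (p z) * ((p z + 1) / (F (p z) + 1))\<^sup>2) \<longlongrightarrow> of_real (1 / c)) G" by simp
    moreover have "\<forall>\<^sub>F z in G. deriv F (p z) * ((p z + 1) / (F (p z) + 1))\<^sup>2 = deriv \<phi> z"
      using ev[of 0] by eventually_elim (simp add: F_def p_def deriv_self_map_eq[OF phi zeta])
    ultimately show "(deriv \<phi> \<longlongrightarrow> of_real (1 / c)) (at \<zeta> within stolz_region \<zeta> M)"
      unfolding G_def by (rule Lim_transform_eventually)
    have "filterlim (\<lambda>z. F (p z) / p z * p z) at_infinity G"
      by (rule tendsto_mult_filterlim_at_infinity[OF q1 _ pinf]) (use c in auto)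
    hence "filterlim (\<lambda>z. F (p z) / p z * p z + 1) at_infinity G"
      by (rule tendsto_add_filterlim_at_infinity'[OF _ tendsto_const])
    hence "((\<lambda>z. \<zeta> - 2 * \<zeta> / (F (p z) / p z * p z + 1)) \<longlongrightarrow> \<zeta> - 0) G"
      by (intro tendsto_diff tendsto_const tendsto_divide_0[OF tendsto_const])
    moreover have "\<forall>\<^sub>F z in G. \<zeta> - 2 * \<zeta> / (F (p z) / p z * p z + 1) = \<phi> z"
      using ev[of 1]
    proof eventually_elim
      case (elim z)
      hence z: "norm z < 1" and pz: "p z \<noteq> 0" by auto
      have "Re (F (p z)) > 0" using elim Re_half_plane_conj_pos[OF phi zeta] by (simp add: F_def)
      hence "F (p z) \<noteq> -1" by auto
      hence "\<zeta> - 2 * \<zeta> / (F (p z) + 1) = cayley_inv \<zeta> (F (p z))" by (simp add: cayley_inv_eq)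
      also have "\<dots> = \<phi> z"
        unfolding F_def p_def half_plane_conj_cayley[OF zeta z]
        using zeta analytic_self_mapD(2)[OF phi z] by (intro cayley_inv_cayley) auto
      finally show ?case using pz by simp
    qed
    ultimately show "(\<phi> \<longlongrightarrow> \<zeta>) (at \<zeta> within stolz_region \<zeta> M)"
      unfolding G_def by (simp add: Lim_transform_eventually)
  qed
  show "boundary_fixed_point \<phi> \<zeta>" using lims(1) zeta by (simp add: boundary_fixed_point_def nontangential_limit_def)
  show "has_multiplier \<phi> \<zeta> (1 / c)" using lims(2) by (simp add: has_multiplier_def nontangential_limit_def)
qed

subsection \<open>Backward orbits in the disk\<close>

lemma pseudo_hyp_dist_nonneg: "pseudo_hyp_dist z w \<ge> 0"
  by (simp add: pseudo_hyp_dist_def)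

lemma pseudo_hyp_dist_sq:
  "(pseudo_hyp_dist z w)\<^sup>2 = (norm (z - w))\<^sup>2 / ((norm (z - w))\<^sup>2 + (1 - (norm z)\<^sup>2) * (1 - (norm w)\<^sup>2))"
  unfolding pseudo_hyp_dist_def power_divide norm_one_minus_cnj_mult_sq ..

lemma hyperbolic_step_eq:
  assumes "norm z < 1" "norm w < 1"
  shows "(norm (z - w))\<^sup>2 / ((1 - (norm z)\<^sup>2) * (1 - (norm w)\<^sup>2))
       = (pseudo_hyp_dist z w)\<^sup>2 / (1 - (pseudo_hyp_dist z w)\<^sup>2)"
proof -
  define X where "X = (norm (z - w))\<^sup>2"
  define P where "P = (1 - (norm z)\<^sup>2) * (1 - (norm w)\<^sup>2)"
  have P: "P > 0" using assms norm_less_1_iff_sq by (auto simp: P_def)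
  have X: "X \<ge> 0" by (simp add: X_def)
  have XP: "X + P > 0" using X P by linarith
  hence "1 - X / (X + P) = P / (X + P)" by (simp add: field_simps)
  thus ?thesis unfolding pseudo_hyp_dist_sq X_def[symmetric] P_def[symmetric] using XP P by simp
qed

lemma funpow_norm_less_1:
  assumes "analytic_self_map \<phi>" "norm z < 1"
  shows "norm ((\<phi> ^^ n) z) < 1"
  by (induction n) (use assms in \<open>auto intro: analytic_self_mapD(2)\<close>)

lemma denjoy_wolff_point_LIMSEQ:
  assumes "denjoy_wolff_point \<phi> \<tau>" "norm z < 1"
  shows "(\<lambda>n. (\<phi> ^^ n) z) \<longlonglongrightarrow> \<tau>"
proof -
  have "compact {z} \<and> {z} \<subseteq> unit_disk" using assms by simp
  hence "uniform_limit {z} (\<lambda>n. \<phi> ^^ n) (\<lambda>_. \<tau>) sequentially"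
    using assms(1) unfolding denjoy_wolff_point_def by blast
  thus ?thesis by (rule tendsto_uniform_limitI) simp
qed

locale bounded_backward_orbit =
  fixes \<phi> :: "complex \<Rightarrow> complex" and \<tau> :: complex and w :: "nat \<Rightarrow> complex" and a :: real
  assumes phi: "analytic_self_map \<phi>"
    and not_ell: "\<not> elliptic_automorphism \<phi>"
    and dw: "denjoy_wolff_point \<phi> \<tau>"
    and backward: "backward_iteration \<phi> w"
    and nontriv: "\<not> (\<forall>n. w n = \<tau>)"
    and mono: "incseq (\<lambda>n. pseudo_hyp_dist (w n) (w (Suc n)))"
    and lim: "(\<lambda>n. pseudo_hyp_dist (w n) (w (Suc n))) \<longlonglongrightarrow> a"
    and a1: "a < 1"
begin

lemma w: "norm (w n) < 1" "\<phi> (w (Suc n)) = w n"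
  using backward by (auto simp: backward_iteration_def)

lemma funpow_w: "(\<phi> ^^ k) (w (n + k)) = w n"
proof (induction k)
  case (Suc k)
  thus ?case using w(2)[of "n + k"] by (simp add: funpow_swap1)
qed simp

text \<open>If the orbit returned to a compact disk infinitely often, the uniform convergence of the
  iterates there, applied to \<open>funpow_w\<close>, would give w m = \<tau> for every m.\<close>

lemma norm_w_tendsto_1: "(\<lambda>n. norm (w n)) \<longlonglongrightarrow> 1"
proof (rule ccontr)
  assume neg: "\<not> ?thesis"
  then obtain r where r: "r < 1" "\<exists>\<^sub>F n in sequentially. norm (w n) \<le> r"
  proof -
    obtain e where e: "e > 0" "\<not> (\<forall>\<^sub>F n in sequentially. dist (norm (w n)) 1 < e)"
      using neg by (auto simp: tendsto_iff)
    have "\<exists>\<^sub>F n in sequentially. norm (w n) \<le> 1 - e"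
      using e(2) unfolding not_eventually
      by (rule frequently_elim1) (use w(1) in \<open>force simp: dist_real_def abs_if\<close>)
    thus ?thesis using that[of "1 - e"] e by simp
  qed
  have "w m = \<tau>" for m
  proof (rule ccontr)
    assume "w m \<noteq> \<tau>"
    hence "dist (w m) \<tau> > 0" by simp
    moreover have "compact (cball 0 r :: complex set)" "cball 0 r \<subseteq> ball (0::complex) 1" using r by auto
    hence "uniform_limit (cball 0 r) (\<lambda>n. \<phi> ^^ n) (\<lambda>_. \<tau>) sequentially"
      using dw by (auto simp: denjoy_wolff_point_def)
    ultimately have "\<forall>\<^sub>F n in sequentially. \<forall>x\<in>cball 0 r. dist ((\<phi> ^^ n) x) \<tau> < dist (w m) \<tau>"
      unfolding uniform_limit_iff by blast
    then obtain N where N: "\<And>n x. n \<ge> N \<Longrightarrow> norm x \<le> r \<Longrightarrow> dist ((\<phi> ^^ n) x) \<tau> < dist (w m) \<tau>"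
      unfolding eventually_sequentially by force
    obtain n where n: "n \<ge> N + m" "norm (w n) \<le> r"
      using r(2) unfolding frequently_sequentially by blast
    have "(\<phi> ^^ (n - m)) (w n) = w m" using funpow_w[of "n - m" m] n by simp
    moreover have "N \<le> n - m" using n(1) by linarith
    ultimately show False using N[of "n - m" "w n"] n(2) by simp
  qed
  thus False using nontriv by blast
qed

lemma dist_le_a: "pseudo_hyp_dist (w n) (w (Suc n)) \<le> a"
  using incseq_le[OF mono lim] .

text \<open>With a = 0 all steps vanish, and a constant orbit inside the disk cannot approach the
  circle.\<close>

lemma a_pos: "a > 0"
proof (rule ccontr)
  assume "\<not> a > 0"
  hence "pseudo_hyp_dist (w n) (w (Suc n)) = 0" for n
    using dist_le_a[of n] pseudo_hyp_dist_nonneg[of "w n" "w (Suc n)"] by linarith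
  hence "(norm (w n - w (Suc n)))\<^sup>2 / ((1 - (norm (w n))\<^sup>2) * (1 - (norm (w (Suc n)))\<^sup>2)) = 0" for n
    using hyperbolic_step_eq[OF w(1) w(1)] by simp
  moreover have "1 - (norm (w n))\<^sup>2 \<noteq> 0" for n using w(1)[of n] norm_less_1_iff_sq[of "w n"] by linarith
  ultimately have "w (Suc n) = w n" for n by simp
  hence "w n = w 0" for n by (induction n) auto
  hence "(\<lambda>n. norm (w n)) = (\<lambda>_. norm (w 0))" by metis
  hence "(\<lambda>n. norm (w 0)) \<longlonglongrightarrow> 1" using norm_w_tendsto_1 by metis
  thus False using w(1)[of 0] by (simp add: LIMSEQ_const_iff)
qed

definition \<kappa> :: real where "\<kappa> = a\<^sup>2 / (1 - a\<^sup>2)"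

lemma a_sq: "a\<^sup>2 < 1" using a1 a_pos by (simp add: abs_square_less_1)

lemma kappa_pos: "\<kappa> > 0"
  using a_sq a_pos by (simp add: \<kappa>_def)

lemma step_le:
  "(norm (w n - w (Suc n)))\<^sup>2 \<le> \<kappa> * ((1 - (norm (w n))\<^sup>2) * (1 - (norm (w (Suc n)))\<^sup>2))"
proof -
  define d where "d = pseudo_hyp_dist (w n) (w (Suc n))"
  have d: "d\<^sup>2 \<le> a\<^sup>2" unfolding d_def by (intro power_mono dist_le_a pseudo_hyp_dist_nonneg)
  have "(norm (w n - w (Suc n)))\<^sup>2 / ((1 - (norm (w n))\<^sup>2) * (1 - (norm (w (Suc n)))\<^sup>2)) = d\<^sup>2 / (1 - d\<^sup>2)"
    unfolding d_def by (rule hyperbolic_step_eq[OF w(1) w(1)])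
  also have "\<dots> \<le> \<kappa>" unfolding \<kappa>_def using d a_sq by (intro frac_le) auto
  finally show ?thesis
    using w(1)[of n] w(1)[of "Suc n"] unfolding norm_less_1_iff_sq by (simp add: pos_divide_le_eq)
qed

lemma step_tendsto:
  "(\<lambda>n. (norm (w n - w (Suc n)))\<^sup>2 / ((1 - (norm (w n))\<^sup>2) * (1 - (norm (w (Suc n)))\<^sup>2))) \<longlonglongrightarrow> \<kappa>"
  unfolding hyperbolic_step_eq[OF w(1) w(1)] \<kappa>_def
  using a_sq by (intro tendsto_intros lim) auto

text \<open>Near the circle, bounded hyperbolic steps are small in the Euclidean sense.\<close>

lemma dist_step_tendsto_0: "(\<lambda>n. dist (w n) (w (Suc n))) \<longlonglongrightarrow> 0"
proof -
  have "(\<lambda>n. \<kappa> * ((1 - (norm (w n))\<^sup>2) * (1 - (norm (w (Suc n)))\<^sup>2))) \<longlonglongrightarrow> \<kappa> * ((1 - 1\<^sup>2) * (1 - 1\<^sup>2))"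
    by (intro tendsto_intros norm_w_tendsto_1 LIMSEQ_Suc[OF norm_w_tendsto_1])
  hence "(\<lambda>n. sqrt (\<kappa> * ((1 - (norm (w n))\<^sup>2) * (1 - (norm (w (Suc n)))\<^sup>2)))) \<longlonglongrightarrow> sqrt 0"
    by (intro tendsto_real_sqrt) simp
  moreover have "dist (w n) (w (Suc n)) \<le> sqrt (\<kappa> * ((1 - (norm (w n))\<^sup>2) * (1 - (norm (w (Suc n)))\<^sup>2)))" for n
    using step_le[of n] by (intro real_le_rsqrt) (simp add: dist_norm)
  ultimately show ?thesis
    by (intro Lim_null_comparison[of "\<lambda>n. dist (w n) (w (Suc n))"] always_eventually) auto
qed

lemma bounded_w: "bounded (range w)"
  using w(1) by (intro boundedI[of _ 1]) (auto simp: less_imp_le)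

definition A :: real where "A = 4 / (1 - a\<^sup>2)"

lemma A_pos: "A > 0" using a_sq by (simp add: A_def)

text \<open>Bound |1 - cnj (w n) w (Suc n)| below by 1 - |w n| and its square above by \<kappa> + 1
  times the product of both boundary distances. The constant \<open>A\<close> equals 4 (\<kappa> +
  1).\<close>

lemma boundary_distance_ratio: "1 - (norm (w n))\<^sup>2 \<le> A * (1 - (norm (w (Suc n)))\<^sup>2)"
proof -
  define s where "s = 1 - (norm (w n))\<^sup>2"
  define t where "t = 1 - (norm (w (Suc n)))\<^sup>2"
  have st: "s > 0" "t > 0" using w(1) norm_less_1_iff_sq by (auto simp: s_def t_def)
  have "norm (cnj (w n) * w (Suc n)) \<le> norm (w n) * 1"
    unfolding norm_mult complex_mod_cnj using w(1)[of "Suc n"] by (intro mult_left_mono) auto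
  hence "1 - norm (w n) \<le> norm (1 - cnj (w n) * w (Suc n))"
    using norm_triangle_ineq2[of 1 "cnj (w n) * w (Suc n)"] by simp
  moreover have "s \<le> 2 * (1 - norm (w n))"
    using zero_le_power2[of "1 - norm (w n)"] by (simp add: s_def power2_diff)
  ultimately have "s / 2 \<le> norm (1 - cnj (w n) * w (Suc n))" by simp
  hence "(s / 2)\<^sup>2 \<le> (norm (1 - cnj (w n) * w (Suc n)))\<^sup>2" using st by (intro power_mono) auto
  also have "\<dots> = (norm (w n - w (Suc n)))\<^sup>2 + s * t" unfolding norm_one_minus_cnj_mult_sq s_def t_def ..
  also have "\<dots> \<le> \<kappa> * (s * t) + s * t" using step_le[of n] by (simp add: s_def t_def)
  also have "\<dots> = (\<kappa> + 1) * t * s" by (simp add: algebra_simps)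
  finally have "s * s \<le> (4 * (\<kappa> + 1) * t) * s" by (simp add: power2_eq_square algebra_simps)
  hence "s \<le> 4 * (\<kappa> + 1) * t" using st by simp
  moreover have "4 * (\<kappa> + 1) = A" using a_sq by (simp add: \<kappa>_def A_def field_simps)
  ultimately show ?thesis by (simp add: s_def t_def)
qed

text \<open>Julia's lemma along a subsequence of \<open>w (Suc n)\<close>, whose images
  \<open>w n\<close> have the same limit. The constant \<open>A\<close> is common to all cluster
  points.\<close>

lemma cluster_point_Julia:
  assumes "\<zeta> \<in> cluster_points w"
  shows "norm \<zeta> = 1" "norm z < 1 \<Longrightarrow> Re (cayley \<zeta> z) \<le> A * Re (cayley \<zeta> (\<phi> z))"
proof -
  obtain r where r: "strict_mono (r :: nat \<Rightarrow> nat)" "(w \<circ> r) \<longlonglongrightarrow> \<zeta>"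
    using cluster_points_subseq[OF assms] .
  have "(\<lambda>n. norm (w (r n))) \<longlonglongrightarrow> norm \<zeta>" using r(2) by (intro tendsto_norm) (simp add: comp_def)
  moreover have "(\<lambda>n. norm (w (r n))) \<longlonglongrightarrow> 1"
    using LIMSEQ_subseq_LIMSEQ[OF norm_w_tendsto_1 r(1)] by (simp add: comp_def)
  ultimately show 1: "norm \<zeta> = 1" by (rule LIMSEQ_unique)
  have "(\<lambda>n. dist (w (r n)) (w (Suc (r n)))) \<longlonglongrightarrow> 0"
    using LIMSEQ_subseq_LIMSEQ[OF dist_step_tendsto_0 r(1)] by (simp add: comp_def)
  hence "(\<lambda>n. w (r n) - w (Suc (r n))) \<longlonglongrightarrow> 0"
    by (subst (asm) dist_norm) (rule tendsto_norm_zero_cancel)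
  from tendsto_diff[OF r(2)[unfolded comp_def] this] have "(\<lambda>n. w (Suc (r n))) \<longlonglongrightarrow> \<zeta>" by simp
  moreover have "(\<lambda>n. \<phi> (w (Suc (r n)))) \<longlonglongrightarrow> \<zeta>" using r(2) by (simp add: w(2) comp_def)
  ultimately show "norm z < 1 \<Longrightarrow> Re (cayley \<zeta> z) \<le> A * Re (cayley \<zeta> (\<phi> z))"
    using Julia_lemma[OF analytic_self_mapD(1)[OF phi] analytic_self_mapD(2)[OF phi] 1, of "\<lambda>n. w (Suc (r n))" A z]
      boundary_distance_ratio w by simp
qed

text \<open>Since \<open>A\<close> is the same along the whole arc, Julia's lemma bounds \<phi> z -
  z on the radii ending there uniformly by a quantity tending to 0.\<close>

lemma cluster_points_singleton: "\<exists>\<zeta>. cluster_points w \<subseteq> {\<zeta>}"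
proof (rule ccontr)
  assume "\<not> ?thesis"
  then obtain p q where pq: "p \<in> cluster_points w" "q \<in> cluster_points w" "p \<noteq> q" by blast
  have "cluster_points w \<subseteq> sphere 0 1" using cluster_point_Julia(1) by auto
  from connected_subset_circle_contains_arc[OF connected_cluster_points[OF bounded_w dist_step_tendsto_0] this pq]
  obtain s t where st: "s < t" "\<And>\<theta>. \<theta> \<in> {s..t} \<Longrightarrow> cis \<theta> \<in> cluster_points w"
    by blast
  \<comment> \<open>The two terms bound the distances of \<phi> z and of z = r \<zeta> from
    \<zeta>.\<close>
  define \<eta> where "\<eta> = (\<lambda>r::real. sqrt (A * (1 - r)) + (1 - r))"
  have "\<phi> z - z = 0" if z: "norm z < 1" for z
  proof (rule vanishing_on_arc_imp_zero[of "\<lambda>z. \<phi> z - z" 2 s t \<eta>])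
    show "(\<lambda>z. \<phi> z - z) holomorphic_on ball 0 1"
      by (intro holomorphic_intros analytic_self_mapD(1)[OF phi])
    show "norm (\<phi> z - z) \<le> 2" if "norm z < 1" for z
      using norm_triangle_ineq4[of "\<phi> z" z] analytic_self_mapD(2)[OF phi that] that by linarith
    have "(\<eta> \<longlongrightarrow> sqrt (A * (1 - 1)) + (1 - 1)) (at_left 1)"
      unfolding \<eta>_def by (intro tendsto_intros)
    thus "(\<eta> \<longlongrightarrow> 0) (at_left 1)" by simp
    show "norm (\<phi> (of_real r * cis \<theta>) - of_real r * cis \<theta>) \<le> \<eta> r"
      if r: "0 < r" "r < 1" and "\<theta> \<in> {s..t}" for r \<theta>
    proof -
      define \<zeta> where "\<zeta> = cis \<theta>"
      define z where "z = of_real r * cis \<theta>"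
      have z1: "norm z = r" "norm z < 1" using r by (auto simp: z_def norm_mult)
      have zc: "\<zeta> \<in> cluster_points w" unfolding \<zeta>_def by (rule st(2)) fact
      have zeta: "norm \<zeta> = 1" by (simp add: \<zeta>_def)
      have phi1: "norm (\<phi> z) < 1" by (rule analytic_self_mapD(2)[OF phi z1(2)])
      have "\<zeta> - z = of_real (1 - r) * cis \<theta>" by (simp add: \<zeta>_def z_def algebra_simps)
      hence zz: "norm (\<zeta> - z) = 1 - r" using r by (simp add: norm_mult del: of_real_diff)
      have "\<zeta> \<noteq> \<phi> z" using zeta phi1 by auto
      hence pos: "(norm (\<zeta> - \<phi> z))\<^sup>2 > 0" by simp
      have "1 / (1 - r) \<le> (1 - r\<^sup>2) / (1 - r)\<^sup>2"
        using r by (simp add: divide_simps power2_eq_square)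
      also have "\<dots> = Re (cayley \<zeta> z)" by (simp add: Re_cayley[OF zeta] z1 zz)
      also have "\<dots> \<le> A * Re (cayley \<zeta> (\<phi> z))" by (rule cluster_point_Julia(2)[OF zc z1(2)])
      also have "\<dots> \<le> A * (1 / (norm (\<zeta> - \<phi> z))\<^sup>2)"
        unfolding Re_cayley[OF zeta] using A_pos by (intro mult_left_mono divide_right_mono) auto
      finally have "(norm (\<zeta> - \<phi> z))\<^sup>2 \<le> A * (1 - r)"
        using pos r by (simp add: divide_simps)
      hence "norm (\<zeta> - \<phi> z) \<le> sqrt (A * (1 - r))" by (rule real_le_rsqrt)
      moreover have "norm (\<phi> z - z) \<le> norm (\<zeta> - \<phi> z) + norm (\<zeta> - z)"
        using norm_triangle_ineq4[of "\<zeta> - z" "\<zeta> - \<phi> z"] by (simp add: algebra_simps)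
      ultimately show ?thesis by (simp add: \<eta>_def zz flip: z_def)
    qed
  qed (use st z in auto)
  hence id: "\<phi> z = z" if "z \<in> ball 0 1" for z using that by simp
  have "elliptic_automorphism \<phi>"
    unfolding elliptic_automorphism_def
  proof (intro conjI bexI)
    show "bij_betw \<phi> unit_disk unit_disk"
      using bij_betw_cong[of "ball 0 1" \<phi> "\<lambda>x. x" "ball 0 1"] id by (simp add: bij_betw_def)
    show "\<phi> 0 = 0" by (rule id) simp
  qed (use analytic_self_mapD(1)[OF phi] in auto)
  thus False using not_ell by contradiction
qed

section \<open>The limit point and the transfer of the orbit to the half-plane\<close>

definition \<zeta> :: complex where "\<zeta> = lim w"

lemma w_tendsto: "w \<longlonglongrightarrow> \<zeta>"
  using cluster_points_singleton convergent_if_cluster_points_singleton[OF bounded_w]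
  unfolding \<zeta>_def by (metis limI)

lemma zeta_cluster: "\<zeta> \<in> cluster_points w"
  using cluster_pointsI_subseq[of id w \<zeta>] w_tendsto by (simp add: strict_mono_def)

lemma norm_zeta: "norm \<zeta> = 1"
  by (rule cluster_point_Julia(1)[OF zeta_cluster])

definition F where "F = half_plane_conj \<phi> \<zeta>"
definition U where "U n = cayley \<zeta> (w n)"

lemma F_cayley: "norm z < 1 \<Longrightarrow> F (cayley \<zeta> z) = cayley \<zeta> (\<phi> z)"
  unfolding F_def by (rule half_plane_conj_cayley[OF norm_zeta])

lemma zeta_ne: "norm z < 1 \<Longrightarrow> \<zeta> \<noteq> z"
  using norm_zeta by auto

lemma U_at_infinity: "filterlim U at_infinity sequentially"
proof -
  have "(\<lambda>n. \<zeta> - w n) \<longlonglongrightarrow> \<zeta> - \<zeta>" by (intro tendsto_intros w_tendsto)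
  hence "filterlim (\<lambda>n. \<zeta> - w n) (at 0) sequentially"
    using zeta_ne[OF w(1)] by (auto simp: filterlim_at)
  moreover have "(\<lambda>n. \<zeta> + w n) \<longlonglongrightarrow> \<zeta> + \<zeta>" by (intro tendsto_intros w_tendsto)
  moreover have "\<zeta> + \<zeta> \<noteq> 0" using norm_zeta by auto
  ultimately have "filterlim (\<lambda>n. (\<zeta> + w n) * inverse (\<zeta> - w n)) at_infinity sequentially"
    by (intro tendsto_mult_filterlim_at_infinity filterlim_compose[OF filterlim_inverse_at_infinity])
  thus ?thesis by (simp add: U_def[abs_def] cayley_def divide_inverse)
qed

lemma U_step_eq:
  "(norm (U n - U (Suc n)))\<^sup>2 / (Re (U n) * Re (U (Suc n)))
     = 4 * ((norm (w n - w (Suc n)))\<^sup>2 / ((1 - (norm (w n))\<^sup>2) * (1 - (norm (w (Suc n)))\<^sup>2)))"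
proof -
  define P where "P = (1 - (norm (w n))\<^sup>2) * (1 - (norm (w (Suc n)))\<^sup>2)"
  define R where "R = Re (U n) * Re (U (Suc n))"
  have "P > 0" using w(1)[of n] w(1)[of "Suc n"] unfolding norm_less_1_iff_sq by (simp add: P_def)
  moreover have "R > 0" using Re_cayley_pos[OF norm_zeta w(1)] by (simp add: R_def U_def)
  moreover have "(norm (U n - U (Suc n)))\<^sup>2 * P = 4 * (norm (w n - w (Suc n)))\<^sup>2 * R"
    using cayley_half_plane_invariant[OF norm_zeta w(1) w(1)] by (simp add: P_def R_def U_def)
  ultimately show ?thesis unfolding P_def[symmetric] R_def[symmetric] by (simp add: field_simps)
qed

lemma Re_U_pos: "Re (U n) > 0"
  unfolding U_def by (rule Re_cayley_pos[OF norm_zeta w(1)])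

text \<open>Positivity of c comes from \<open>cluster_point_Julia\<close>: 1 / A is an admissible
  constant. The step bound becomes 4 \<kappa> by \<open>U_step_eq\<close>.\<close>

lemma half_plane_orbit:
  obtains c where "half_plane_backward_orbit F U (4 * \<kappa>) c"
    "\<And>c'. (\<And>u. Re u > 0 \<Longrightarrow> c' * Re u \<le> Re (F u)) \<Longrightarrow> c' \<le> c"
proof -
  have Fpos: "Re (F u) > 0" if "Re u > 0" for u
    unfolding F_def by (rule Re_half_plane_conj_pos[OF phi norm_zeta that])
  obtain c where c: "\<And>u. Re u > 0 \<Longrightarrow> c * Re u \<le> Re (F u)"
    "\<And>\<epsilon>. \<epsilon> > 0 \<Longrightarrow> \<exists>v. Re v > 0 \<and> Re (F v) < (c + \<epsilon>) * Re v"
    "\<And>c'. (\<And>u. Re u > 0 \<Longrightarrow> c' * Re u \<le> Re (F u)) \<Longrightarrow> c' \<le> c"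
    using best_half_plane_constant[of F, OF Fpos] by metis
  have "1 / A \<le> c"
  proof (rule c(3))
    fix u :: complex assume "Re u > 0"
    then obtain z where z: "norm z < 1" "u = cayley \<zeta> z" using cayley_inv_surj[OF norm_zeta] by blast
    show "1 / A * Re u \<le> Re (F u)"
      using cluster_point_Julia(2)[OF zeta_cluster z(1)] A_pos
      by (simp add: z F_cayley pos_divide_le_eq mult.commute)
  qed
  hence c0: "c > 0" using A_pos by (smt (verit) zero_less_divide_1_iff)
  have "half_plane_backward_orbit F U (4 * \<kappa>) c"
  proof
    show "F holomorphic_on right_half_plane" unfolding F_def by (rule half_plane_conj_holomorphic[OF phi norm_zeta])
    show "F (U (Suc n)) = U n" for n by (simp add: U_def F_cayley w)
    show "(norm (U n - U (Suc n)))\<^sup>2 \<le> 4 * \<kappa> * (Re (U n) * Re (U (Suc n)))" for n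
    proof -
      have "0 < (1 - (norm (w n))\<^sup>2) * (1 - (norm (w (Suc n)))\<^sup>2)"
        using w(1)[of n] w(1)[of "Suc n"] unfolding norm_less_1_iff_sq by simp
      hence "(norm (U n - U (Suc n)))\<^sup>2 / (Re (U n) * Re (U (Suc n))) \<le> 4 * \<kappa>"
        unfolding U_step_eq using step_le[of n] by (simp add: pos_divide_le_eq)
      thus ?thesis using Re_U_pos[of n] Re_U_pos[of "Suc n"] by (simp add: pos_divide_le_eq)
    qed
  qed (use c c0 Fpos Re_U_pos U_at_infinity kappa_pos in auto)
  thus ?thesis using that c(3) by blast
qed

text \<open>If the constant is at least 1, all horodisks at \<open>\<zeta>\<close> are invariant, so that forward orbits
  cannot converge to any other point.\<close>
lemma Julia_constant_less_1:
  assumes "\<zeta> \<noteq> \<tau>" and c_le: "\<And>u. Re u > 0 \<Longrightarrow> c * Re u \<le> Re (F u)"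
  shows "c < 1"
proof (rule ccontr)
  assume "\<not> c < 1"
  hence c1: "c \<ge> 1" by simp
  have inv: "Re (cayley \<zeta> z) \<le> Re (cayley \<zeta> (\<phi> z))" if "norm z < 1" for z
  proof -
    have "Re (cayley \<zeta> z) > 0" by (rule Re_cayley_pos[OF norm_zeta that])
    hence "1 * Re (cayley \<zeta> z) \<le> c * Re (cayley \<zeta> z)" using c1 by (intro mult_right_mono) auto
    also have "\<dots> \<le> Re (cayley \<zeta> (\<phi> z))"
      using c_le[OF \<open>Re (cayley \<zeta> z) > 0\<close>] by (simp add: F_cayley that)
    finally show ?thesis by simp
  qed
  have iter: "Re (cayley \<zeta> z) \<le> Re (cayley \<zeta> ((\<phi> ^^ n) z))" if "norm z < 1" for z n
  proof (induction n)
    case (Suc n)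
    thus ?case using inv[OF funpow_norm_less_1[OF phi that, of n]] by simp
  qed simp
  \<comment> \<open>A starting point in a horodisk at \<open>\<zeta>\<close> that is too small to
    have \<open>\<tau>\<close> in its closure.\<close>
  define x where "x = \<bar>Re (cayley \<zeta> \<tau>)\<bar> + 1"
  have "Re (complex_of_real x) > 0" by (simp add: x_def)
  then obtain z where z: "norm z < 1" "of_real x = cayley \<zeta> z" using cayley_inv_surj[OF norm_zeta] by blast
  have "(\<lambda>n. Re (cayley \<zeta> ((\<phi> ^^ n) z))) \<longlonglongrightarrow> Re (cayley \<zeta> \<tau>)"
    unfolding cayley_def using assms(1)
    by (intro tendsto_intros denjoy_wolff_point_LIMSEQ[OF dw z(1)]) auto
  hence "Re (cayley \<zeta> z) \<le> Re (cayley \<zeta> \<tau>)"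
    using iter[OF z(1)] by (intro LIMSEQ_le_const) auto
  moreover have "Re (cayley \<zeta> z) = x" by (simp flip: z(2))
  ultimately show False by (simp add: x_def)
qed

text \<open>The forward orbit of 0 tends to the circle, so infinitely often its modulus does not
  decrease. Along these indices Julia's lemma holds with constant 1.\<close>

lemma Julia_at_denjoy_wolff_point:
  assumes "\<zeta> = \<tau>" and "Re u > 0"
  shows "Re u \<le> Re (F u)"
proof -
  define x where "x = (\<lambda>n. (\<phi> ^^ n) 0)"
  have x1: "norm (x n) < 1" for n unfolding x_def by (rule funpow_norm_less_1[OF phi]) simp
  have xlim: "x \<longlonglongrightarrow> \<zeta>" unfolding x_def assms(1) by (rule denjoy_wolff_point_LIMSEQ[OF dw]) simp
  have "\<exists>n\<ge>N. norm (x n) \<le> norm (x (Suc n))" for N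
  proof (rule ccontr)
    assume "\<not> ?thesis"
    hence dec: "norm (x (Suc n)) \<le> norm (x n)" if "n \<ge> N" for n using that by (meson le_cases)
    have "norm (x n) \<le> norm (x N)" if "n \<ge> N" for n
      using that
    proof (induction n rule: dec_induct)
      case (step n)
      thus ?case using dec[of n] by linarith
    qed simp
    moreover have "(\<lambda>n. norm (x n)) \<longlonglongrightarrow> norm \<zeta>" by (intro tendsto_intros xlim)
    ultimately have "norm \<zeta> \<le> norm (x N)" by (intro LIMSEQ_le_const2) auto
    thus False using x1[of N] norm_zeta by simp
  qed
  hence "infinite {n. norm (x n) \<le> norm (x (Suc n))}"
    by (auto simp: infinite_nat_iff_unbounded_le)
  then obtain r :: "nat \<Rightarrow> nat" where r: "strict_mono r" "\<And>k. r k \<in> {n. norm (x n) \<le> norm (x (Suc n))}"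
    using infinite_enumerate by blast
  obtain z where z: "norm z < 1" "u = cayley \<zeta> z" using cayley_inv_surj[OF norm_zeta assms(2)] by blast
  have phix: "\<phi> (x n) = x (Suc n)" for n by (simp add: x_def)
  have "(\<lambda>k. x (r k)) \<longlonglongrightarrow> \<zeta>" using LIMSEQ_subseq_LIMSEQ[OF xlim r(1)] by (simp add: comp_def)
  moreover have "(\<lambda>k. \<phi> (x (r k))) \<longlonglongrightarrow> \<zeta>"
    using LIMSEQ_subseq_LIMSEQ[OF LIMSEQ_Suc[OF xlim] r(1)] by (simp add: comp_def phix)
  moreover have "1 - (norm (\<phi> (x (r k))))\<^sup>2 \<le> 1 * (1 - (norm (x (r k)))\<^sup>2)" for k
    using r(2)[of k] by (simp add: phix power_mono)
  ultimately have "Re (cayley \<zeta> z) \<le> 1 * Re (cayley \<zeta> (\<phi> z))"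
    by (intro Julia_lemma[OF analytic_self_mapD(1)[OF phi] analytic_self_mapD(2)[OF phi] norm_zeta x1 _ _ _ z(1)])
  thus ?thesis by (simp add: z F_cayley)
qed

lemma one_minus_cnj_zeta_mult: "norm z < 1 \<Longrightarrow> 1 - cnj \<zeta> * z = 2 / (cayley \<zeta> z + 1)"
proof -
  assume "norm z < 1"
  hence ne: "\<zeta> \<noteq> z" by (rule zeta_ne)
  have zz: "\<zeta> * cnj \<zeta> = 1" using norm_zeta complex_norm_square[of \<zeta>] by simp
  have "\<zeta> \<noteq> 0" using norm_zeta by auto
  hence "2 / (cayley \<zeta> z + 1) = (\<zeta> - z) / \<zeta>"
    unfolding cayley_plus_1[OF ne] by (simp add: field_simps)
  also have "\<dots> = 1 - cnj \<zeta> * z" using zz \<open>\<zeta> \<noteq> 0\<close> by (simp add: field_simps)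
  finally show ?thesis ..
qed

text \<open>By \<open>one_minus_cnj_zeta_mult\<close> the argument is that of 2 / (U n + 1),
  unchanged by the positive factor |U n|. As Re e > 0, the limit 2 / e avoids the branch
  cut.\<close>

lemma Arg_tendsto:
  assumes e: "Re e > 0" and lim_e: "(\<lambda>n. U n / norm (U n)) \<longlonglongrightarrow> e"
  shows "\<exists>\<theta>\<in>{-pi/2<..<pi/2}. (\<lambda>n. Arg (1 - cnj \<zeta> * w n)) \<longlonglongrightarrow> \<theta>"
proof
  have e0: "e \<noteq> 0" using e by auto
  have Re2: "Re (2 / e) > 0"
    using e e0 by (simp add: Re_divide cmod_power2[symmetric] zero_less_mult_iff)
  thus "Arg (2 / e) \<in> {-pi/2<..<pi/2}"
    using Arg_Re_pos[of "2 / e"] by (simp add: abs_less_iff) linarith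
  have "(\<lambda>n. 1 / norm (U n)) \<longlonglongrightarrow> 0"
    by (intro tendsto_divide_0[OF tendsto_const]
        filterlim_at_top_imp_at_infinity filterlim_at_infinity_imp_norm_at_top U_at_infinity)
  hence "(\<lambda>n. complex_of_real (1 / norm (U n))) \<longlonglongrightarrow> of_real 0" by (rule tendsto_of_real)
  from tendsto_add[OF lim_e this] have "(\<lambda>n. (U n + 1) / norm (U n)) \<longlonglongrightarrow> e"
    by (simp add: add_divide_distrib)
  hence "(\<lambda>n. 2 / ((U n + 1) / norm (U n))) \<longlonglongrightarrow> 2 / e" using e0 by (intro tendsto_intros)
  moreover have "isCont Arg (2 / e)"
    using Re2 by (intro continuous_at_Arg) (auto simp: complex_nonpos_Reals_iff)
  ultimately have "(\<lambda>n. Arg (2 / ((U n + 1) / norm (U n)))) \<longlonglongrightarrow> Arg (2 / e)"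
    by (rule isCont_tendsto_compose[rotated])
  moreover have "Arg (2 / ((U n + 1) / norm (U n))) = Arg (1 - cnj \<zeta> * w n)" for n
  proof -
    have "norm (U n) > 0" using Re_U_pos[of n] by auto
    moreover have "2 / ((U n + 1) / norm (U n)) = (1 - cnj \<zeta> * w n) * of_real (norm (U n))"
      unfolding one_minus_cnj_zeta_mult[OF w(1)] by (simp add: U_def)
    ultimately show ?thesis by (simp add: Arg_times_of_real2)
  qed
  ultimately show "(\<lambda>n. Arg (1 - cnj \<zeta> * w n)) \<longlonglongrightarrow> Arg (2 / e)" by simp
qed

text \<open>The real parts of \<open>U n\<close> do not increase, so the orbit stays outside a
  horodisk at \<open>\<zeta>\<close>. Hence 1 - |w n| is at most of the order of |\<zeta> - w
  n|^2.\<close>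

lemma tangential:
  assumes mono: "\<And>u. Re u > 0 \<Longrightarrow> Re u \<le> Re (F u)"
  shows "tends_tangentially w \<zeta>"
proof -
  have dec: "Re (U (Suc n)) \<le> Re (U n)" for n
    using mono[OF Re_U_pos[of "Suc n"]] by (simp add: U_def F_cayley w)
  have U0: "Re (U n) \<le> Re (U 0)" for n
    by (induction n) (use dec order_trans in auto)
  have le: "(1 - norm (w n)) / norm (\<zeta> - w n) \<le> Re (U 0) * norm (\<zeta> - w n)" for n
  proof -
    have pos: "norm (\<zeta> - w n) > 0" using zeta_ne[OF w(1)] by simp
    have "(norm (w n))\<^sup>2 \<le> norm (w n)" using w(1)[of n] by (simp add: power2_eq_square mult_left_le)
    hence "(1 - norm (w n)) / norm (\<zeta> - w n) \<le> (1 - (norm (w n))\<^sup>2) / norm (\<zeta> - w n)"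
      by (intro divide_right_mono) auto
    also have "\<dots> = Re (U n) * norm (\<zeta> - w n)"
      using pos by (simp add: U_def Re_cayley[OF norm_zeta] power2_eq_square)
    also have "\<dots> \<le> Re (U 0) * norm (\<zeta> - w n)" by (intro mult_right_mono U0) auto
    finally show ?thesis .
  qed
  have "(\<lambda>n. Re (U 0) * norm (\<zeta> - w n)) \<longlonglongrightarrow> Re (U 0) * norm (\<zeta> - \<zeta>)"
    by (intro tendsto_intros w_tendsto)
  hence up: "(\<lambda>n. Re (U 0) * norm (\<zeta> - w n)) \<longlonglongrightarrow> 0" by simp
  have "(\<lambda>n. (1 - norm (w n)) / norm (\<zeta> - w n)) \<longlonglongrightarrow> 0"
    by (rule tendsto_sandwich[OF _ _ tendsto_const up])
       (use le w(1) in \<open>auto intro!: always_eventually divide_nonneg_nonneg simp: less_imp_le\<close>)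
  thus ?thesis using w_tendsto by (simp add: tends_tangentially_def)
qed

end

section \<open>Reading the four assertions off the constant \<open>c\<close>\<close>

theorem theorem1p6:
  fixes \<phi> :: "complex \<Rightarrow> complex" and \<tau> :: complex and w :: "nat \<Rightarrow> complex" and a :: real
  assumes "analytic_self_map \<phi>"
    and "\<not> elliptic_automorphism \<phi>"
    and "denjoy_wolff_point \<phi> \<tau>"
    and "backward_iteration \<phi> w"
    and "\<not> (\<forall>n. w n = \<tau>)"
    and "incseq (\<lambda>n. pseudo_hyp_dist (w n) (w (Suc n)))"
    and "(\<lambda>n. pseudo_hyp_dist (w n) (w (Suc n))) \<longlonglongrightarrow> a"
    and "a < 1"
  shows "\<exists>\<zeta>\<in>sphere 0 1.
     (w \<longlonglongrightarrow> \<zeta> \<and> boundary_fixed_point \<phi> \<zeta> \<and> (\<exists>m. has_multiplier \<phi> \<zeta> m)) \<and>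
     ((\<zeta> \<noteq> \<tau> \<longrightarrow> BRFP \<phi> \<tau> \<zeta>) \<and> (\<zeta> = \<tau> \<longrightarrow> parabolic_type \<phi> \<tau>)) \<and>
     (BRFP \<phi> \<tau> \<zeta> \<longrightarrow>
        (\<exists>\<theta>\<^sub>0\<in>{-pi/2<..<pi/2}. (\<lambda>n. Arg (1 - cnj \<zeta> * w n)) \<longlonglongrightarrow> \<theta>\<^sub>0)) \<and>
     (parabolic_type \<phi> \<tau> \<and> \<zeta> = \<tau> \<longrightarrow> tends_tangentially w \<zeta>)"
proof -
  interpret bounded_backward_orbit \<phi> \<tau> w a
    using assms by unfold_locales
  obtain c where "half_plane_backward_orbit F U (4 * \<kappa>) c"
    and c_max: "\<And>c'. (\<And>u. Re u > 0 \<Longrightarrow> c' * Re u \<le> Re (F u)) \<Longrightarrow> c' \<le> c"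
    using half_plane_orbit by blast
  then interpret H: half_plane_backward_orbit F U "4 * \<kappa>" c by simp
  \<comment> \<open>The multiplier at \<open>\<zeta>\<close> is 1 / c; comparing \<open>c\<close>
    with 1 then separates the repelling from the parabolic case.\<close>
  have JWC: "boundary_fixed_point \<phi> \<zeta>" "has_multiplier \<phi> \<zeta> (1 / c)"
    using Julia_Wolff_Caratheodory[OF phi norm_zeta H.c_pos] H.c_le H.best unfolding F_def by blast+
  show ?thesis
  proof (intro bexI[of _ \<zeta>] conjI impI)
    show "\<zeta> \<in> sphere 0 1" by (simp add: norm_zeta)
    show "w \<longlonglongrightarrow> \<zeta>" by (rule w_tendsto)
    show "boundary_fixed_point \<phi> \<zeta>" "\<exists>m. has_multiplier \<phi> \<zeta> m" using JWC by blast+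
    show "BRFP \<phi> \<tau> \<zeta>" if "\<zeta> \<noteq> \<tau>"
    proof -
      have "c < 1" by (rule Julia_constant_less_1[OF that H.c_le])
      thus ?thesis unfolding BRFP_def using JWC that H.c_pos by (auto intro!: exI[of _ "1 / c"])
    qed
    show "parabolic_type \<phi> \<tau>" if "\<zeta> = \<tau>"
    proof -
      \<comment> \<open>At the Denjoy-Wolff point 1 is an admissible constant, while the backward
        orbit excludes c > 1; so the hyperbolic case cannot occur.\<close>
      have "1 \<le> c" using c_max[of 1] Julia_at_denjoy_wolff_point[OF that] by simp
      hence "c = 1" using H.c_le_1 by simp
      thus ?thesis using JWC dw norm_zeta that by (simp add: parabolic_type_def)
    qed
    show "\<exists>\<theta>\<^sub>0\<in>{-pi/2<..<pi/2}. (\<lambda>n. Arg (1 - cnj \<zeta> * w n)) \<longlonglongrightarrow> \<theta>\<^sub>0" if "BRFP \<phi> \<tau> \<zeta>"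
    proof -
      have "c < 1" using that by (intro Julia_constant_less_1 H.c_le) (simp add: BRFP_def)
      moreover have "(\<lambda>n. (norm (U n - U (Suc n)))\<^sup>2 / (Re (U n) * Re (U (Suc n)))) \<longlonglongrightarrow> 4 * \<kappa>"
        unfolding U_step_eq by (intro tendsto_intros step_tendsto)
      ultimately obtain e where "Re e > 0" "(\<lambda>n. U n / norm (U n)) \<longlonglongrightarrow> e"
        by (rule H.direction_convergent)
      thus ?thesis by (rule Arg_tendsto)
    qed
    show "tends_tangentially w \<zeta>" if "parabolic_type \<phi> \<tau> \<and> \<zeta> = \<tau>"
      using that Julia_at_denjoy_wolff_point by (intro tangential) blast
  qed
qed

end
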